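(* Let $\{p_k\}_{k\in\Gamma}$ be a finitely supported family of real numbers with $\sum_{k\in\Gamma}p_k=1$ satisfying the orthonormality conditions $$\sum_{k\in\Gamma}p_k\,p_{k+Mi}=\begin{cases}\tfrac12 & \text{if } i=0,\\ 0 & \text{if } i\neq0,\end{cases}\qquad\text{for all } i\in\Gamma,$$ and let $(\mu_n)_{n\ge1}$ be the associated sequence of discrete measures defined in the context. Then the total variation norms of the $\mu_n$ are uniformly bounded; in particular, if $N$ is a constant such that $$\mathrm{card}(\mathrm{supp}(\mu_n))\le \mathrm{card}(S_n)\le \mathrm{card}\left(B_R(0)\cap M^{-n}\Gamma\right)\le N\cdot 2^n\quad\text{for all } n\ge1,$$ then $\|\mu_n\|_{\mathrm{TV}}\le\sqrt{N}$ for all $n\ge 1$. Thus $\mu_n$ converges weakly to a pseudo-probability measure $\mu$.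
   Context: Two cases are treated simultaneously. Either $m=1$, $\Gamma=\mathbb{Z}\subset\mathbb{R}$, $M$ is multiplication by $2$ on $\mathbb{R}$, and $|M|=2$; or $m=2$, $\Gamma=\mathbb{Z}^2\subset\mathbb{R}^2$, where $\mathbb{R}^2$ is identified with $\mathbb{C}$ (so $\Gamma$ is the Gaussian integers), $M$ is multiplication by the complex number $1+\sqrt{-1}$, and $|M|=\sqrt2$. (In the orthonormality conditions, $i$ denotes an index in $\Gamma$, not the imaginary unit.) A pseudo-probability measure is a finite signed Borel measure $\mu$ on $\mathbb{R}^m$ with $\mu(\mathbb{R}^m)=1$. Let $\delta_x$ be the unit point mass at $x$, let $D(x)=M^{-1}x$, and let $D_\star$ be the push-forward by $D$ on signed measures. Define $\mu_1=\sum_{k\in\Gamma}p_k\,\delta_{M^{-1}k}$ and, for $n\ge2$, $\mu_n=\mu_1\star D_\star(\mu_{n-1})$, where $\star$ is convolution. Let $\tilde\Gamma=\{k\in\Gamma:p_k\ne0\}$, let $S_n=\{\sum_{j=1}^nM^{-j}\tilde\gamma_j:\tilde\gamma_j\in\tilde\Gamma\text{ for all }j\}$ (which contains $\mathrm{supp}(\mu_n)$), let $R=\max_{\tilde\gamma\in\tilde\Gamma}|\tilde\gamma|/(|M|-1)$, and let $B_R(0)$ be the ball of radius $R$ around the origin in $\mathbb{R}^m$. A constant $N$, depending only on $M$ and $\tilde\Gamma$, for which the displayed chain of inequalities holds for all $n$ exists. Weak convergence $\nu_n\to\nu$ of finite signed measures means $\int f\,d\nu_n\to\int f\,d\nu$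 for every bounded continuous real function $f$ on $\mathbb{R}^m$. *)

theory Defs
  imports "HOL-Analysis.Analysis"
begin

text \<open>
  A finite signed Borel measure is represented by its set function; only the values on Borel sets
  are relevant.
\<close>

definition finite_signed_measure :: "('a::topological_space set \<Rightarrow> real) \<Rightarrow> bool" where
  "finite_signed_measure \<nu> \<longleftrightarrow> \<nu> {} = 0 \<and>
     (\<forall>A::nat \<Rightarrow> 'a set. range A \<subseteq> sets borel \<and> disjoint_family A \<longrightarrow>
        (\<lambda>i. \<nu> (A i)) sums \<nu> (\<Union>i. A i))"

definition pseudo_probability_measure :: "('a::topological_space set \<Rightarrow> real) \<Rightarrow> bool" where
  "pseudo_probability_measure \<nu> \<longleftrightarrow> finite_signed_measure \<nu> \<and> \<nu> UNIV = 1"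

definition total_variation :: "('a::topological_space set \<Rightarrow> real) \<Rightarrow> 'a set \<Rightarrow> ennreal" where
  "total_variation \<nu> A =
     (SUP P \<in> {P. finite P \<and> disjoint P \<and> P \<subseteq> sets borel \<and> \<Union>P = A}. \<Sum>B\<in>P. ennreal \<bar>\<nu> B\<bar>)"

definition tv_norm :: "('a::topological_space set \<Rightarrow> real) \<Rightarrow> ennreal" where
  "tv_norm \<nu> = total_variation \<nu> UNIV"

definition signed_support :: "('a::topological_space set \<Rightarrow> real) \<Rightarrow> 'a set" where
  "signed_support \<nu> = {x. \<forall>U. open U \<and> x \<in> U \<longrightarrow> total_variation \<nu> U > 0}"

text \<open>
  The upper variation, i.e. the positive part of the Jordan decomposition. Since \<open>\<nu> {} = 0\<close>, it
  does no harm that \<^const>\<open>ennreal\<close> truncates negative values to 0. The negative part of \<open>\<nu>\<close> is the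
  upper variation of \<open>- \<nu>\<close>.
\<close>

definition upper_variation :: "('a::topological_space set \<Rightarrow> real) \<Rightarrow> 'a measure" where
  "upper_variation \<nu> = measure_of UNIV (sets borel)
     (\<lambda>A. SUP B \<in> {B \<in> sets borel. B \<subseteq> A}. ennreal (\<nu> B))"

definition signed_integral ::
    "('a::topological_space set \<Rightarrow> real) \<Rightarrow> ('a \<Rightarrow> real) \<Rightarrow> real" where
  "signed_integral \<nu> f =
     (\<integral>x. f x \<partial>upper_variation \<nu>) - (\<integral>x. f x \<partial>upper_variation (\<lambda>A. - \<nu> A))"

definition weakly_converges ::
    "(nat \<Rightarrow> 'a::topological_space set \<Rightarrow> real) \<Rightarrow> ('a set \<Rightarrow> real) \<Rightarrow> bool" where
  "weakly_converges \<nu>s \<nu> \<longleftrightarrow>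
     (\<forall>f::'a \<Rightarrow> real. continuous_on UNIV f \<and> bounded (range f) \<longrightarrow>
        (\<lambda>n. signed_integral (\<nu>s n) f) \<longlonglongrightarrow> signed_integral \<nu> f)"

definition point_mass :: "'a \<Rightarrow> 'a set \<Rightarrow> real" where
  "point_mass x A = indicator A x"

definition push_forward :: "('a \<Rightarrow> 'b) \<Rightarrow> ('a set \<Rightarrow> real) \<Rightarrow> 'b set \<Rightarrow> real" where
  "push_forward f \<nu> A = \<nu> (f -` A)"

text \<open>The iterated integral of \<open>indicator A (x + y)\<close>, first over \<open>y\<close> and then over \<open>x\<close>.\<close>

definition signed_convolution ::
    "('a::{topological_space,plus} set \<Rightarrow> real) \<Rightarrow> ('a set \<Rightarrow> real) \<Rightarrow> 'a set \<Rightarrow> real" where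
  "signed_convolution \<mu> \<nu> A = signed_integral \<mu> (\<lambda>x. \<nu> ((\<lambda>y. x + y) -` A))"

text \<open>
  The dilation \<open>M\<close> is multiplication by the scalar \<open>c\<close>, so \<open>\<bar>M\<bar>\<close> is \<open>norm c\<close>; the plane is the
  type \<^typ>\<open>complex\<close>. The lattice is \<open>G\<close>, and only the values of \<open>p\<close> on \<open>G\<close> matter.
\<close>

definition gaussian_integers :: "complex set" where
  "gaussian_integers = {z. Re z \<in> \<int> \<and> Im z \<in> \<int>}"

definition mask_support :: "'a set \<Rightarrow> ('a \<Rightarrow> real) \<Rightarrow> 'a set" where
  "mask_support G p = {k \<in> G. p k \<noteq> 0}"

definition orthonormal_mask :: "'a::real_normed_field \<Rightarrow> 'a set \<Rightarrow> ('a \<Rightarrow> real) \<Rightarrow> bool" where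
  "orthonormal_mask c G p \<longleftrightarrow>
     finite (mask_support G p) \<and>
     (\<Sum>\<^sub>\<infinity>k\<in>G. p k) = 1 \<and>
     (\<forall>i\<in>G. (\<Sum>\<^sub>\<infinity>k\<in>G. p k * p (k + c * i)) = (if i = 0 then 1 / 2 else 0))"

definition mask_measure ::
    "'a::real_normed_field \<Rightarrow> 'a set \<Rightarrow> ('a \<Rightarrow> real) \<Rightarrow> 'a set \<Rightarrow> real" where
  "mask_measure c G p A = (\<Sum>\<^sub>\<infinity>k\<in>G. p k * point_mass (k / c) A)"

text \<open>The sequence starts at index 1; the value at index 0 is a dummy.\<close>

fun cascade ::
    "'a::real_normed_field \<Rightarrow> 'a set \<Rightarrow> ('a \<Rightarrow> real) \<Rightarrow> nat \<Rightarrow> 'a set \<Rightarrow> real" where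
  "cascade c G p 0 = point_mass 0"
| "cascade c G p (Suc 0) = mask_measure c G p"
| "cascade c G p (Suc (Suc n)) =
     signed_convolution (mask_measure c G p)
       (push_forward (\<lambda>x. x / c) (cascade c G p (Suc n)))"

definition digit_sums :: "'a::real_normed_field \<Rightarrow> 'a set \<Rightarrow> ('a \<Rightarrow> real) \<Rightarrow> nat \<Rightarrow> 'a set" where
  "digit_sums c G p n =
     {\<Sum>j=1..n. \<gamma> j / c ^ j | \<gamma>. \<forall>j\<in>{1..n}. \<gamma> j \<in> mask_support G p}"

definition support_radius :: "'a::real_normed_field \<Rightarrow> 'a set \<Rightarrow> ('a \<Rightarrow> real) \<Rightarrow> real" where
  "support_radius c G p = Max (norm ` mask_support G p) / (norm c - 1)"

definition cardinality_bound ::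
    "'a::real_normed_field \<Rightarrow> 'a set \<Rightarrow> ('a \<Rightarrow> real) \<Rightarrow> real \<Rightarrow> bool" where
  "cardinality_bound c G p N \<longleftrightarrow>
     (\<forall>n\<ge>1.
        card (signed_support (cascade c G p n)) \<le> card (digit_sums c G p n) \<and>
        card (digit_sums c G p n)
          \<le> card (ball 0 (support_radius c G p) \<inter> (\<lambda>x. x / c ^ n) ` G) \<and>
        real (card (ball 0 (support_radius c G p) \<inter> (\<lambda>x. x / c ^ n) ` G)) \<le> N * 2 ^ n)"

end

theory Submission
  imports Defs "HOL-Probability.Probability_Measure"
begin

text \<open>
  The orthonormality conditions propagate by induction: the atoms of \<open>\<mu>\<^sub>n\<close> have square sum
  \<open>1 / 2\<^sup>n\<close>, so by Cauchy-Schwarz the total variation is at most the square root of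
  \<open>card (supp \<mu>\<^sub>n) / 2\<^sup>n\<close>, and packing disjoint balls of volume proportional to \<open>1 / 2\<^sup>n\<close> around
  the atoms bounds this uniformly.

  For the limit, the \<open>\<mu>\<^sub>n\<close>-integrals of a Lipschitz function form a Cauchy sequence. No Riesz
  representation is needed: spreading each atom over its ball gives densities bounded in \<open>L\<^sup>2\<close>, so
  that the mass of a Borel set \<open>A\<close> is at most a constant times the square root of its volume, for
  all \<open>n\<close>. Approximating indicators by Lipschitz functions, the masses of every Borel set converge,
  and the same bound makes the limit countably additive. Bounded continuous functions are then
  handled by uniform approximation with simple functions.
\<close>

section \<open>Functionals on bounded Borel functions\<close>

definition bounded_borel :: "('a::topological_space \<Rightarrow> real) \<Rightarrow> bool" where
  "bounded_borel f \<longleftrightarrow> f \<in> borel_measurable borel \<and> (\<exists>B. \<forall>x. \<bar>f x\<bar> \<le> B)"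

text \<open>One notion covers every functional compared later: signed integrals, finite sums of
  point evaluations and averages over balls. Quantifying over all bounds \<open>e\<close> of
  \<bar>f\<bar> replaces the supremum norm, and the single clause for \<open>f x + s * g x\<close>
  encodes linearity.\<close>

definition bounded_functional :: "real \<Rightarrow> (('a::topological_space \<Rightarrow> real) \<Rightarrow> real) \<Rightarrow> bool" where
  "bounded_functional C L \<longleftrightarrow>
     (\<forall>f g s. bounded_borel f \<longrightarrow> bounded_borel g \<longrightarrow> L (\<lambda>x. f x + s * g x) = L f + s * L g) \<and>
     (\<forall>f e. bounded_borel f \<longrightarrow> (\<forall>x. \<bar>f x\<bar> \<le> e) \<longrightarrow> \<bar>L f\<bar> \<le> C * e)"

lemma bounded_borel_const [simp]: "bounded_borel (\<lambda>x. s)"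
  by (auto simp: bounded_borel_def)

lemma bounded_borel_indicator: "A \<in> sets borel \<Longrightarrow> bounded_borel (indicator A)"
  unfolding bounded_borel_def
  by (intro conjI exI[of _ 1] borel_measurable_indicator) (auto simp: indicator_def)

lemma bounded_borel_add_scale:
  assumes "bounded_borel f" "bounded_borel g"
  shows "bounded_borel (\<lambda>x. f x + s * g x)"
proof -
  obtain A B where "\<forall>x. \<bar>f x\<bar> \<le> A" "\<forall>x. \<bar>g x\<bar> \<le> B"
    using assms unfolding bounded_borel_def by blast
  then have "\<forall>x. \<bar>f x + s * g x\<bar> \<le> A + \<bar>s\<bar> * B"
    by (metis abs_ge_zero abs_mult abs_triangle_ineq add_mono mult_left_mono order_trans)
  moreover have "(\<lambda>x. f x + s * g x) \<in> borel_measurable borel"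
    using assms by (auto simp: bounded_borel_def)
  ultimately show ?thesis unfolding bounded_borel_def by blast
qed

lemma bounded_borel_diff:
  "bounded_borel f \<Longrightarrow> bounded_borel g \<Longrightarrow> bounded_borel (\<lambda>x. f x - g x)"
  using bounded_borel_add_scale[of f g "-1"] by simp

lemma bounded_borel_sum:
  assumes "\<And>i. i \<in> I \<Longrightarrow> bounded_borel (f i)"
  shows "bounded_borel (\<lambda>x. \<Sum>i\<in>I. w i * f i x)"
  using assms
proof (induction I rule: infinite_finite_induct)
  case (insert i I)
  have "bounded_borel (\<lambda>x. (\<Sum>i\<in>I. w i * f i x) + w i * f i x)"
    using insert by (intro bounded_borel_add_scale) auto
  with insert show ?case by (simp add: add.commute)
qed auto

lemma bounded_functional_add_scale:
  "\<lbrakk>bounded_functional C L; bounded_borel f; bounded_borel g\<rbrakk>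
    \<Longrightarrow> L (\<lambda>x. f x + s * g x) = L f + s * L g"
  by (simp add: bounded_functional_def)

lemma bounded_functional_diff:
  "\<lbrakk>bounded_functional C L; bounded_borel f; bounded_borel g\<rbrakk> \<Longrightarrow> L (\<lambda>x. f x - g x) = L f - L g"
  using bounded_functional_add_scale[of C L f g "-1"] by simp

lemma bounded_functional_le:
  "\<lbrakk>bounded_functional C L; bounded_borel f; \<And>x. \<bar>f x\<bar> \<le> e\<rbrakk> \<Longrightarrow> \<bar>L f\<bar> \<le> C * e"
  unfolding bounded_functional_def by blast

lemma bounded_functional_zero:
  assumes "bounded_functional C L"
  shows "L (\<lambda>x. 0) = 0"
  using bounded_functional_le[OF assms, of "\<lambda>x. 0" 0] by simp

lemma bounded_functional_mono:
  assumes "bounded_functional C L" "C \<le> D"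
  shows "bounded_functional D L"
proof -
  have "\<bar>L f\<bar> \<le> D * e" if "bounded_borel f" "\<forall>x. \<bar>f x\<bar> \<le> e" for f e
  proof -
    have "0 \<le> e" using that(2) abs_ge_zero order_trans by blast
    then have "C * e \<le> D * e" using assms(2) by (rule mult_right_mono[rotated])
    then show ?thesis using bounded_functional_le[OF assms(1) that(1)] that(2) by force
  qed
  with assms(1) show ?thesis unfolding bounded_functional_def by blast
qed

lemma bounded_functional_sum_apply:
  assumes "bounded_functional C L" "\<And>i. i \<in> I \<Longrightarrow> bounded_borel (f i)"
  shows "L (\<lambda>x. \<Sum>i\<in>I. w i * f i x) = (\<Sum>i\<in>I. w i * L (f i))"
  using assms(2)
proof (induction I rule: infinite_finite_induct)
  case (insert i I)
  have "L (\<lambda>x. (\<Sum>i\<in>I. w i * f i x) + w i * f i x) = L (\<lambda>x. \<Sum>i\<in>I. w i * f i x) + w i * L (f i)"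
    using insert.prems by (intro bounded_functional_add_scale[OF assms(1)] bounded_borel_sum) auto
  with insert show ?case by (simp add: add.commute)
qed (auto simp: bounded_functional_zero[OF assms(1)])

text \<open>The building blocks are left abstract so that the same bound serves sums of point masses
  and sums of ball averages.\<close>

lemma bounded_functional_combination:
  assumes "\<And>x. x \<in> X \<Longrightarrow> bounded_functional 1 (T x)"
  shows "bounded_functional (\<Sum>x\<in>X. \<bar>a x\<bar>) (\<lambda>f. \<Sum>x\<in>X. a x * T x f)"
  unfolding bounded_functional_def
proof (intro conjI allI impI)
  fix f g :: "'b \<Rightarrow> real" and s :: real
  assume "bounded_borel f" "bounded_borel g"
  then have "(\<Sum>x\<in>X. a x * T x (\<lambda>y. f y + s * g y)) = (\<Sum>x\<in>X. a x * T x f + s * (a x * T x g))"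
    by (intro sum.cong) (auto simp: bounded_functional_add_scale[OF assms] algebra_simps)
  then show "(\<Sum>x\<in>X. a x * T x (\<lambda>y. f y + s * g y)) =
      (\<Sum>x\<in>X. a x * T x f) + s * (\<Sum>x\<in>X. a x * T x g)"
    by (simp add: sum.distrib sum_distrib_left)
next
  fix f :: "'b \<Rightarrow> real" and e
  assume f: "bounded_borel f" "\<forall>x. \<bar>f x\<bar> \<le> e"
  have "\<bar>\<Sum>x\<in>X. a x * T x f\<bar> \<le> (\<Sum>x\<in>X. \<bar>a x\<bar> * e)"
  proof (intro order_trans[OF sum_abs] sum_mono)
    fix x assume "x \<in> X"
    then show "\<bar>a x * T x f\<bar> \<le> \<bar>a x\<bar> * e"
      using bounded_functional_le[OF assms, of x f e] f by (simp add: abs_mult mult_left_mono)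
  qed
  then show "\<bar>\<Sum>x\<in>X. a x * T x f\<bar> \<le> (\<Sum>x\<in>X. \<bar>a x\<bar>) * e"
    by (simp add: sum_distrib_right)
qed

lemma bounded_functional_eval: "bounded_functional 1 (\<lambda>f. f x)"
  by (auto simp: bounded_functional_def)

section \<open>Integrals against finite measures, and approximation by simple functions\<close>

lemma finite_measure_integrable_bounded_borel:
  assumes "finite_measure M" "sets M = sets borel" "bounded_borel f"
  shows "integrable M f"
proof -
  obtain B where "\<forall>x. \<bar>f x\<bar> \<le> B" using assms(3) by (auto simp: bounded_borel_def)
  moreover have "f \<in> borel_measurable M"
    using assms(2,3) by (simp add: bounded_borel_def cong: measurable_cong_sets)
  ultimately show ?thesis
    by (intro finite_measure.integrable_const_bound[OF assms(1), of _ B]) auto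
qed

lemma bounded_functional_integral:
  assumes "finite_measure M" "sets M = sets borel"
  shows "bounded_functional (measure M (space M)) (integral\<^sup>L M)"
  unfolding bounded_functional_def
proof (intro conjI allI impI)
  fix f g :: "'a \<Rightarrow> real" and s :: real
  assume "bounded_borel f" "bounded_borel g"
  then show "(\<integral>x. f x + s * g x \<partial>M) = integral\<^sup>L M f + s * integral\<^sup>L M g"
    by (simp add: finite_measure_integrable_bounded_borel[OF assms])
next
  fix f :: "'a \<Rightarrow> real" and e
  assume f: "bounded_borel f" "\<forall>x. \<bar>f x\<bar> \<le> e"
  then have int: "integrable M f" by (intro finite_measure_integrable_bounded_borel[OF assms])
  have "\<bar>integral\<^sup>L M f\<bar> \<le> (\<integral>x. \<bar>f x\<bar> \<partial>M)" by (rule integral_abs_bound)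
  also have "\<dots> \<le> (\<integral>x. e \<partial>M)"
    using f(2) int by (intro integral_mono integrable_abs)
      (auto intro: finite_measure_integrable_bounded_borel[OF assms])
  finally have "\<bar>integral\<^sup>L M f\<bar> \<le> (\<integral>x. e \<partial>M)" .
  then show "\<bar>integral\<^sup>L M f\<bar> \<le> measure M (space M) * e" by simp
qed

text \<open>Rounding \<open>f\<close> down to the nearest multiple of \<open>e\<close> costs at most
  \<open>e\<close>, and boundedness leaves only finitely many levels.\<close>

lemma simple_approximation:
  fixes f :: "'a::topological_space \<Rightarrow> real"
  assumes f: "bounded_borel f" and e: "e > 0"
  obtains I :: "int set" and A :: "int \<Rightarrow> 'a set"
  where "finite I" "\<And>i. A i \<in> sets borel"
    "\<And>x. \<bar>f x - (\<Sum>i\<in>I. e * of_int i * indicator (A i) x)\<bar> \<le> e"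
proof -
  have fm [measurable]: "f \<in> borel_measurable borel" using f by (simp add: bounded_borel_def)
  obtain B where B: "\<And>x. \<bar>f x\<bar> \<le> B" using f by (auto simp: bounded_borel_def)
  define I where "I = {\<lfloor>- B / e\<rfloor>..\<lfloor>B / e\<rfloor>}"
  define A where "A i = {x. \<lfloor>f x / e\<rfloor> = i}" for i
  have "A i \<in> sets borel" for i unfolding A_def by measurable
  moreover have "\<bar>f x - (\<Sum>i\<in>I. e * of_int i * indicator (A i) x)\<bar> \<le> e" for x
  proof -
    have "\<lfloor>f x / e\<rfloor> \<in> I"
    proof -
      have "- B / e \<le> f x / e" "f x / e \<le> B / e"
        using B[of x] e by (auto simp: abs_le_iff field_simps)
      then show ?thesis unfolding I_def by (auto intro: floor_mono)
    qed
    moreover have "e * of_int i * indicator (A i) x = (if i = \<lfloor>f x / e\<rfloor> then e * of_int i else 0)"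
      for i by (auto simp: A_def indicator_def)
    moreover have "finite I" by (simp add: I_def)
    ultimately have "(\<Sum>i\<in>I. e * of_int i * indicator (A i) x) = e * of_int \<lfloor>f x / e\<rfloor>"
      by (simp add: sum.delta)
    moreover have "\<bar>f x / e - of_int \<lfloor>f x / e\<rfloor>\<bar> \<le> 1" by linarith
    then have "e * \<bar>f x / e - of_int \<lfloor>f x / e\<rfloor>\<bar> \<le> e * 1"
      using e by (intro mult_left_mono) auto
    then have "\<bar>e * (f x / e - of_int \<lfloor>f x / e\<rfloor>)\<bar> \<le> e"
      using e by (simp add: abs_mult)
    then have "\<bar>f x - e * of_int \<lfloor>f x / e\<rfloor>\<bar> \<le> e"
      using e by (simp add: right_diff_distrib)
    ultimately show ?thesis by simp
  qed
  moreover have "finite I" by (simp add: I_def)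
  ultimately show ?thesis using that by blast
qed

text \<open>Linearity gives convergence on simple functions; the common bound \<open>C\<close>
  carries it to their uniform limits by splitting the error into three parts.\<close>

lemma bounded_functional_tendsto:
  assumes L: "\<And>n. bounded_functional C (L n)" and L': "bounded_functional C L'"
    and lim: "\<And>A. A \<in> sets borel \<Longrightarrow> (\<lambda>n. L n (indicator A)) \<longlonglongrightarrow> L' (indicator A)"
    and f: "bounded_borel f"
  shows "(\<lambda>n. L n f) \<longlonglongrightarrow> L' f"
proof (rule LIMSEQ_I)
  fix r :: real assume r: "r > 0"
  \<comment> \<open>The maximum with 1 keeps the divisor in \<open>e\<close> positive whatever the
    sign of \<open>C\<close>; \<open>e\<close> is then chosen so that replacing \<open>f\<close> by
    a simple function costs at most \<open>r / 3\<close> for each functional.\<close>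
  define D where "D = max C 1"
  have D: "D > 0" "C \<le> D" by (auto simp: D_def)
  define e where "e = r / (3 * D)"
  have e: "e > 0" using r D by (simp add: e_def)
  obtain I :: "int set" and A where I: "finite I" and A: "\<And>i. A i \<in> sets borel"
    and fs: "\<And>x. \<bar>f x - (\<Sum>i\<in>I. e * of_int i * indicator (A i) x)\<bar> \<le> e"
    by (rule simple_approximation[OF f e]) blast
  define s where "s x = (\<Sum>i\<in>I. e * of_int i * indicator (A i) x)" for x
  have s: "bounded_borel s"
    unfolding s_def by (intro bounded_borel_sum bounded_borel_indicator A)
  have err: "\<bar>T f - T s\<bar> \<le> r / 3" if "bounded_functional C T" for T
  proof -
    have T: "bounded_functional D T" using bounded_functional_mono[OF that D(2)] .
    have "\<bar>T (\<lambda>x. f x - s x)\<bar> \<le> D * e"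
      using fs by (intro bounded_functional_le[OF T] bounded_borel_diff f s) (auto simp: s_def)
    then show ?thesis using bounded_functional_diff[OF T f s] D by (simp add: e_def)
  qed
  have sL: "T s = (\<Sum>i\<in>I. e * of_int i * T (indicator (A i)))" if "bounded_functional C T" for T
    unfolding s_def by (rule bounded_functional_sum_apply[OF that]) (intro bounded_borel_indicator A)
  have "(\<lambda>n. L n s) \<longlonglongrightarrow> L' s"
    unfolding sL[OF L] sL[OF L'] by (intro tendsto_sum tendsto_mult tendsto_const lim A)
  then obtain m where m: "\<And>n. n \<ge> m \<Longrightarrow> \<bar>L n s - L' s\<bar> < r / 3"
    using r LIMSEQ_D[of "\<lambda>n. L n s" "L' s" "r / 3"] by auto
  have "norm (L n f - L' f) < r" if "n \<ge> m" for n
    using m[OF that] err[OF L[of n]] err[OF L'] unfolding real_norm_def by linarith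
  then show "\<exists>no. \<forall>n\<ge>no. norm (L n f - L' f) < r" by blast
qed

text \<open>This is the preceding convergence result for a constant sequence. It allows functionals
  to be identified by their values on indicators alone.\<close>

lemma bounded_functional_unique:
  assumes "bounded_functional C L" "bounded_functional D L'"
    and "\<And>A. A \<in> sets borel \<Longrightarrow> L (indicator A) = L' (indicator A)" "bounded_borel f"
  shows "L f = L' f"
proof -
  have "bounded_functional (max C D) L" "bounded_functional (max C D) L'"
    using bounded_functional_mono[OF assms(1)] bounded_functional_mono[OF assms(2)] by auto
  then have "(\<lambda>n::nat. L f) \<longlonglongrightarrow> L' f"
    by (rule bounded_functional_tendsto) (simp_all add: assms)
  then show ?thesis by (simp add: LIMSEQ_const_iff)
qed

section \<open>Bounded signed measures\<close>

text \<open>The explicit bound makes both Jordan parts finite and controls the integral. For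
  discrete measures it is the sum of the absolute coefficients, for the limit it is
  \<open>tv_bound\<close>.\<close>

locale bounded_signed_measure =
  fixes \<nu> :: "'a::topological_space set \<Rightarrow> real" and C :: real
  assumes finite_signed: "finite_signed_measure \<nu>"
    and bounded: "\<And>A. A \<in> sets borel \<Longrightarrow> \<bar>\<nu> A\<bar> \<le> C"
begin

lemma empty [simp]: "\<nu> {} = 0"
  using finite_signed by (simp add: finite_signed_measure_def)

lemma sums_UN:
  "range A \<subseteq> sets borel \<Longrightarrow> disjoint_family A \<Longrightarrow> (\<lambda>i::nat. \<nu> (A i)) sums \<nu> (\<Union>i. A i)"
  using finite_signed by (simp add: finite_signed_measure_def)

lemma additive_Un:
  assumes "A \<in> sets borel" "B \<in> sets borel" "A \<inter> B = {}"
  shows "\<nu> (A \<union> B) = \<nu> A + \<nu> B"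
proof -
  have "(\<lambda>i. \<nu> (binaryset A B i)) sums \<nu> (\<Union>i. binaryset A B i)"
  proof (rule sums_UN)
    show "range (binaryset A B) \<subseteq> sets borel" using assms by (simp add: range_binaryset_eq)
    show "disjoint_family (binaryset A B)"
      using assms by (auto simp: disjoint_family_on_def binaryset_def)
  qed
  moreover have "(\<lambda>i. \<nu> (binaryset A B i)) sums (\<nu> A + \<nu> B)" by (rule binaryset_sums) simp
  ultimately show ?thesis using sums_unique2 by (fastforce simp: UN_binaryset_eq)
qed

section \<open>The upper variation as a finite measure\<close>

abbreviation (input) upper :: "'a set \<Rightarrow> ennreal" where
  "upper A \<equiv> SUP B \<in> {B \<in> sets borel. B \<subseteq> A}. ennreal (\<nu> B)"

text \<open>A Borel subset of \<open>A\<close> and one of \<open>B\<close> unite to a competitor for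
  \<open>A \<union> B\<close>, on which \<open>\<nu>\<close> adds up because the two are
  disjoint.\<close>

lemma upper_superadditive:
  assumes A: "A \<in> sets borel" and B: "B \<in> sets borel" and disj: "A \<inter> B = {}"
  shows "upper A + upper B \<le> upper (A \<union> B)"
proof -
  have ub: "ennreal (\<nu> D) + ennreal (\<nu> E) \<le> upper (A \<union> B)"
    if DE: "D \<in> sets borel" "D \<subseteq> A" "E \<in> sets borel" "E \<subseteq> B" for D E
  proof -
    \<comment> \<open>A set of negative value counts as 0 after truncation, so it is exchanged for
      the empty set. The remaining values are nonnegative, and \<open>ennreal\<close> is additive on
      them.\<close>
    define D' where "D' = (if 0 \<le> \<nu> D then D else {})"
    define E' where "E' = (if 0 \<le> \<nu> E then E else {})"
    have m: "D' \<in> sets borel" "E' \<in> sets borel" "D' \<inter> E' = {}" "D' \<union> E' \<subseteq> A \<union> B"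
      "0 \<le> \<nu> D'" "0 \<le> \<nu> E'"
      using DE disj by (auto simp: D'_def E'_def)
    have "ennreal (\<nu> D) + ennreal (\<nu> E) = ennreal (\<nu> D') + ennreal (\<nu> E')"
      by (auto simp: D'_def E'_def ennreal_neg)
    also have "\<dots> = ennreal (\<nu> (D' \<union> E'))"
      using m by (simp add: additive_Un)
    also have "\<dots> \<le> upper (A \<union> B)"
      using m by (intro SUP_upper) auto
    finally show ?thesis .
  qed
  have ne: "{S \<in> sets borel. S \<subseteq> T} \<noteq> {}" for T :: "'a set" by auto
  have "upper A + upper B = (SUP D \<in> {B \<in> sets borel. B \<subseteq> A}. ennreal (\<nu> D) + upper B)"
    by (rule ennreal_SUP_add_left[OF ne, symmetric])
  also have "\<dots> \<le> upper (A \<union> B)"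
    unfolding ennreal_SUP_add_right[OF ne] using ub by (intro SUP_least) auto
  finally show ?thesis .
qed

text \<open>One inequality is superadditivity for finite unions followed by a limit. For the other,
  a competitor \<open>B\<close> is cut along the sets \<open>A i\<close>; its value is the limit of
  the partial sums, and truncation at 0 is subadditive.\<close>

lemma upper_countably_additive: "countably_additive (sets borel) upper"
  unfolding countably_additive_def
proof (intro allI impI antisym)
  fix A :: "nat \<Rightarrow> 'a set"
  assume A: "range A \<subseteq> sets borel" and disj: "disjoint_family A"
  have partial: "(\<Sum>i<n. upper (A i)) \<le> upper (\<Union>i<n. A i)" for n
  proof (induction n)
    case (Suc n)
    have "(\<Sum>i<Suc n. upper (A i)) \<le> upper (\<Union>i<n. A i) + upper (A n)"
      using Suc by (simp add: add_right_mono)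
    also have "\<dots> \<le> upper ((\<Union>i<n. A i) \<union> A n)"
    proof (rule upper_superadditive)
      have "A i \<inter> A n = {}" if "i < n" for i
        by (rule disjoint_family_onD[OF disj]) (use that in auto)
      then show "(\<Union>i<n. A i) \<inter> A n = {}" by auto
    qed (use A in auto)
    also have "(\<Union>i<n. A i) \<union> A n = (\<Union>i<Suc n. A i)" by (auto simp: lessThan_Suc)
    finally show ?case .
  qed simp
  show "(\<Sum>i. upper (A i)) \<le> upper (\<Union>i. A i)"
  proof (rule suminf_le_const)
    show "summable (\<lambda>i. upper (A i))" by (rule summableI)
    fix n
    have "upper (\<Union>i<n. A i) \<le> upper (\<Union>i. A i)"
      by (intro SUP_subset_mono) auto
    then show "(\<Sum>i<n. upper (A i)) \<le> upper (\<Union>i. A i)" using partial[of n] by (rule order_trans[rotated])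
  qed
  show "upper (\<Union>i. A i) \<le> (\<Sum>i. upper (A i))"
  proof (rule SUP_least)
    fix B assume "B \<in> {B \<in> sets borel. B \<subseteq> (\<Union>i. A i)}"
    then have B: "B \<in> sets borel" "B = (\<Union>i. B \<inter> A i)" by auto
    have "(\<lambda>i. \<nu> (B \<inter> A i)) sums \<nu> (\<Union>i. B \<inter> A i)"
    proof (rule sums_UN)
      show "disjoint_family (\<lambda>i. B \<inter> A i)"
        using disj unfolding disjoint_family_on_def by blast
    qed (use A B in auto)
    then have "(\<lambda>n. \<Sum>i<n. \<nu> (B \<inter> A i)) \<longlonglongrightarrow> \<nu> B" using B(2) by (simp add: sums_def)
    then have "(\<lambda>n. ennreal (\<Sum>i<n. \<nu> (B \<inter> A i))) \<longlonglongrightarrow> ennreal (\<nu> B)" by (rule tendsto_ennrealI)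
    moreover have "ennreal (\<Sum>i<n. \<nu> (B \<inter> A i)) \<le> (\<Sum>i. upper (A i))" for n
    proof -
      have "ennreal (\<Sum>i<n. \<nu> (B \<inter> A i)) \<le> (\<Sum>i<n. ennreal (\<nu> (B \<inter> A i)))"
      proof (induction n)
        case (Suc n)
        have "ennreal (x + y) \<le> ennreal x + ennreal y" for x y
        proof -
          have "x + y \<le> max 0 x + max 0 y" by simp
          then have "ennreal (x + y) \<le> ennreal (max 0 x + max 0 y)" by (rule ennreal_leI)
          also have "\<dots> = ennreal x + ennreal y"
            by (subst ennreal_plus) (auto simp: max_def ennreal_neg)
          finally show ?thesis .
        qed
        from order_trans[OF this add_right_mono[OF Suc]] show ?case by simp
      qed simp
      also have "\<dots> \<le> (\<Sum>i<n. upper (A i))"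
        using A B by (intro sum_mono SUP_upper) auto
      also have "\<dots> \<le> (\<Sum>i. upper (A i))" by (rule sum_le_suminf) auto
      finally show ?thesis .
    qed
    ultimately show "ennreal (\<nu> B) \<le> (\<Sum>i. upper (A i))" by (intro LIMSEQ_le_const2) auto
  qed
qed

lemma sets_upper_variation [simp]: "sets (upper_variation \<nu>) = sets borel"
  and space_upper_variation [simp]: "space (upper_variation \<nu>) = UNIV"
  using sets.sigma_sets_eq[of "borel :: 'a measure"] by (auto simp: upper_variation_def)

lemma emeasure_upper_variation: "A \<in> sets borel \<Longrightarrow> emeasure (upper_variation \<nu>) A = upper A"
  unfolding upper_variation_def
proof (rule emeasure_measure_of_sigma)
  show "sigma_algebra UNIV (sets borel :: 'a set set)"
    using sets.sigma_algebra_axioms[of "borel :: 'a measure"] by simp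
  show "positive (sets borel) upper"
    by (simp add: positive_def flip: bot_ennreal)
qed (rule upper_countably_additive)

lemma measure_upper_variation:
  assumes "A \<in> sets borel"
  shows "emeasure (upper_variation \<nu>) A = ennreal (measure (upper_variation \<nu>) A)"
    and "measure (upper_variation \<nu>) A \<le> C"
proof -
  have C: "0 \<le> C" using bounded[of "{}"] by simp
  have "upper A \<le> ennreal C"
    using bounded by (intro SUP_least ennreal_leI) (auto simp: abs_le_iff)
  then have *: "emeasure (upper_variation \<nu>) A \<le> ennreal C"
    by (simp only: emeasure_upper_variation[OF assms])
  then show **: "emeasure (upper_variation \<nu>) A = ennreal (measure (upper_variation \<nu>) A)"
    by (intro emeasure_eq_ennreal_measure) (auto simp: top_unique)
  show "measure (upper_variation \<nu>) A \<le> C" using * C unfolding ** by simp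
qed

lemma finite_measure_upper_variation: "finite_measure (upper_variation \<nu>)"
  by (rule finite_measureI) (simp add: measure_upper_variation(1))

lemma le_upper_variation:
  assumes "A \<in> sets borel" "B \<in> sets borel" "B \<subseteq> A"
  shows "\<nu> B \<le> measure (upper_variation \<nu>) A"
proof -
  have "ennreal (\<nu> B) \<le> upper A" using assms by (intro SUP_upper) auto
  then have "ennreal (\<nu> B) \<le> ennreal (measure (upper_variation \<nu>) A)"
    using assms(1) by (simp only: emeasure_upper_variation flip: measure_upper_variation(1))
  then show ?thesis by (simp add: ennreal_le_iff)
qed

lemma upper_variation_least:
  assumes "A \<in> sets borel" "\<And>B. B \<in> sets borel \<Longrightarrow> B \<subseteq> A \<Longrightarrow> \<nu> B \<le> t"
  shows "measure (upper_variation \<nu>) A \<le> t"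
proof -
  have "0 \<le> t" using assms(2)[of "{}"] by simp
  have "upper A \<le> ennreal t" using assms by (intro SUP_least ennreal_leI) auto
  then have "ennreal (measure (upper_variation \<nu>) A) \<le> ennreal t"
    using assms(1) by (simp only: emeasure_upper_variation flip: measure_upper_variation(1))
  then show ?thesis using \<open>0 \<le> t\<close> by simp
qed

lemma uminus: "bounded_signed_measure (\<lambda>A. - \<nu> A) C"
proof
  show "finite_signed_measure (\<lambda>A. - \<nu> A)"
    unfolding finite_signed_measure_def using sums_UN by (auto intro!: sums_minus)
qed (simp add: bounded)

end

section \<open>Jordan decomposition and the signed integral\<close>

lemma (in bounded_signed_measure) jordan_decomposition:
  assumes A: "A \<in> sets borel"
  shows "\<nu> A = measure (upper_variation \<nu>) A - measure (upper_variation (\<lambda>A. - \<nu> A)) A"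
proof -
  interpret neg: bounded_signed_measure "\<lambda>A. - \<nu> A" C by (rule uminus)
  have split: "\<nu> A = \<nu> B + \<nu> (A - B)" if "B \<in> sets borel" "B \<subseteq> A" for B
    using additive_Un[of B "A - B"] A that by (simp add: Un_absorb1)
  \<comment> \<open>For \<open>B \<subseteq> A\<close> the value of \<open>B\<close> is that of
    \<open>A\<close> minus that of \<open>A - B\<close>, and the negative part of \<open>A\<close>
    dominates the subtracted term with its sign. The supremum over \<open>B\<close> gives one
    inequality; exchanging signs gives the other.\<close>
  have "measure (upper_variation \<nu>) A \<le> \<nu> A + measure (upper_variation (\<lambda>A. - \<nu> A)) A"
  proof (rule upper_variation_least[OF A])
    fix B assume B: "B \<in> sets borel" "B \<subseteq> A"
    show "\<nu> B \<le> \<nu> A + measure (upper_variation (\<lambda>A. - \<nu> A)) A"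
      using split[OF B] neg.le_upper_variation[OF A, of "A - B"] A B by auto
  qed
  moreover have "measure (upper_variation (\<lambda>A. - \<nu> A)) A \<le> - \<nu> A + measure (upper_variation \<nu>) A"
  proof (rule neg.upper_variation_least[OF A])
    fix B assume B: "B \<in> sets borel" "B \<subseteq> A"
    show "- \<nu> B \<le> - \<nu> A + measure (upper_variation \<nu>) A"
      using split[OF B] le_upper_variation[OF A, of "A - B"] A B by auto
  qed
  ultimately show ?thesis by simp
qed

lemma (in bounded_signed_measure) signed_integral_indicator:
  assumes "A \<in> sets borel"
  shows "signed_integral \<nu> (indicator A) = \<nu> A"
proof -
  interpret neg: bounded_signed_measure "\<lambda>A. - \<nu> A" C by (rule uminus)
  show ?thesis
    using jordan_decomposition[OF assms] assms by (simp add: signed_integral_def)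
qed

text \<open>Each Jordan part has mass at most \<open>C\<close>, hence the factor 2.\<close>

lemma (in bounded_signed_measure) bounded_functional_signed_integral:
  "bounded_functional (2 * C) (signed_integral \<nu>)"
proof -
  interpret neg: bounded_signed_measure "\<lambda>A. - \<nu> A" C by (rule uminus)
  have pos: "bounded_functional C (integral\<^sup>L (upper_variation \<nu>))"
    using measure_upper_variation(2)[of UNIV]
    by (intro bounded_functional_mono[OF bounded_functional_integral]
        finite_measure_upper_variation) auto
  have neg: "bounded_functional C (integral\<^sup>L (upper_variation (\<lambda>A. - \<nu> A)))"
    using neg.measure_upper_variation(2)[of UNIV]
    by (intro bounded_functional_mono[OF bounded_functional_integral]
        neg.finite_measure_upper_variation) auto
  show ?thesis
    unfolding bounded_functional_def signed_integral_def
  proof (intro conjI allI impI)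
    fix f :: "'a \<Rightarrow> real" and e
    assume "bounded_borel f" "\<forall>x. \<bar>f x\<bar> \<le> e"
    then show "\<bar>integral\<^sup>L (upper_variation \<nu>) f - integral\<^sup>L (upper_variation (\<lambda>A. - \<nu> A)) f\<bar> \<le> 2 * C * e"
      using bounded_functional_le[OF pos, of f e] bounded_functional_le[OF neg, of f e] by force
  qed (simp add: bounded_functional_add_scale[OF pos] bounded_functional_add_scale[OF neg] algebra_simps)
qed

section \<open>Finite combinations of point masses\<close>

lemma finite_signed_measure_point_mass: "finite_signed_measure (point_mass x)"
  unfolding finite_signed_measure_def
proof (intro conjI allI impI)
  fix A :: "nat \<Rightarrow> 'a set"
  assume A: "range A \<subseteq> sets borel \<and> disjoint_family A"
  show "(\<lambda>i. point_mass x (A i)) sums point_mass x (\<Union>i. A i)"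
  proof (cases "\<exists>i. x \<in> A i")
    case True
    then obtain j where j: "x \<in> A j" by blast
    have "point_mass x (A i) = (if i = j then 1 else 0)" for i
      using A j disjoint_family_onD[of A UNIV i j] by (auto simp: point_mass_def indicator_def)
    moreover have "point_mass x (\<Union>i. A i) = 1" using j by (auto simp: point_mass_def indicator_def)
    ultimately show ?thesis using sums_single[of j "\<lambda>_. 1::real"] by simp
  qed (simp add: point_mass_def)
qed (simp add: point_mass_def)

lemma bounded_signed_measure_combination:
  assumes "finite I"
  shows "bounded_signed_measure (\<lambda>A. \<Sum>i\<in>I. a i * point_mass (h i) A) (\<Sum>i\<in>I. \<bar>a i\<bar>)"
proof
  have "(\<lambda>j::nat. \<Sum>i\<in>I. a i * point_mass (h i) (A j)) sums (\<Sum>i\<in>I. a i * point_mass (h i) (\<Union>j. A j))"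
    if "range A \<subseteq> sets borel" "disjoint_family A" for A
    using finite_signed_measure_point_mass[unfolded finite_signed_measure_def] that
    by (intro sums_sum sums_mult) auto
  then show "finite_signed_measure (\<lambda>A. \<Sum>i\<in>I. a i * point_mass (h i) A)"
    by (auto simp: finite_signed_measure_def point_mass_def)
next
  fix A :: "'b set"
  have "\<bar>a i * point_mass (h i) A\<bar> \<le> \<bar>a i\<bar>" for i
    by (simp add: point_mass_def indicator_def)
  then show "\<bar>\<Sum>i\<in>I. a i * point_mass (h i) A\<bar> \<le> (\<Sum>i\<in>I. \<bar>a i\<bar>)"
    by (intro order_trans[OF sum_abs] sum_mono) auto
qed

text \<open>Both sides are bounded functionals with the same values on indicators, so uniqueness
  applies and the Jordan parts never have to be computed. The points \<open>h i\<close> may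
  coincide, with cancelling coefficients.\<close>

lemma signed_integral_combination:
  assumes "finite I" "bounded_borel f"
  shows "signed_integral (\<lambda>A. \<Sum>i\<in>I. a i * point_mass (h i) A) f = (\<Sum>i\<in>I. a i * f (h i))"
proof -
  interpret bounded_signed_measure "\<lambda>A. \<Sum>i\<in>I. a i * point_mass (h i) A" "\<Sum>i\<in>I. \<bar>a i\<bar>"
    by (rule bounded_signed_measure_combination[OF assms(1)])
  show ?thesis
    using bounded_functional_signed_integral
      bounded_functional_combination[of I "\<lambda>i f. f (h i)" a, OF bounded_functional_eval] _ assms(2)
    by (rule bounded_functional_unique) (subst signed_integral_indicator, simp_all add: point_mass_def)
qed

text \<open>A point lies in at most one block of a partition; after exchanging the sums each
  coefficient is therefore counted at most once.\<close>

lemma tv_norm_combination_le: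
  assumes "finite I"
  shows "tv_norm (\<lambda>A. \<Sum>i\<in>I. a i * point_mass (h i) A) \<le> ennreal (\<Sum>i\<in>I. \<bar>a i\<bar>)"
  unfolding tv_norm_def total_variation_def
proof (rule SUP_least, clarify)
  fix P :: "'b set set"
  assume P: "finite P" "disjoint P"
  have one: "(\<Sum>B\<in>P. point_mass x B) \<le> 1" for x
  proof (cases "\<exists>B\<in>P. x \<in> B")
    case True
    then obtain B where B: "B \<in> P" "x \<in> B" by blast
    have "point_mass x B' = (if B' = B then 1 else 0)" if "B' \<in> P" for B'
      using B P(2) that unfolding point_mass_def indicator_def disjoint_def by fastforce
    then have "(\<Sum>B'\<in>P. point_mass x B') = (\<Sum>B'\<in>P. if B' = B then 1 else 0)"
      by (intro sum.cong) auto
    then show ?thesis using P(1) B by simp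
  qed (auto simp: point_mass_def)
  have "(\<Sum>B\<in>P. \<bar>\<Sum>i\<in>I. a i * point_mass (h i) B\<bar>) \<le> (\<Sum>B\<in>P. \<Sum>i\<in>I. \<bar>a i\<bar> * point_mass (h i) B)"
    by (intro sum_mono order_trans[OF sum_abs]) (simp add: abs_mult point_mass_def)
  also have "\<dots> = (\<Sum>i\<in>I. \<bar>a i\<bar> * (\<Sum>B\<in>P. point_mass (h i) B))"
    unfolding sum_distrib_left by (rule sum.swap)
  also have "\<dots> \<le> (\<Sum>i\<in>I. \<bar>a i\<bar> * 1)"
    by (intro sum_mono mult_left_mono one) auto
  finally show "(\<Sum>B\<in>P. ennreal \<bar>\<Sum>i\<in>I. a i * point_mass (h i) B\<bar>) \<le> ennreal (\<Sum>i\<in>I. \<bar>a i\<bar>)"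
    by (simp add: sum_ennreal ennreal_leI)
qed

text \<open>Splitting a neighbourhood \<open>U\<close> of \<open>x\<close> into the singleton and
  the rest already shows variation at least \<open>\<bar>a x\<bar>\<close>.\<close>

lemma support_subset_signed_support:
  fixes X :: "'a::t1_space set"
  assumes "finite X"
  shows "{x \<in> X. a x \<noteq> 0} \<subseteq> signed_support (\<lambda>A. \<Sum>x\<in>X. a x * point_mass x A)"
  unfolding signed_support_def
proof (clarify, rule ccontr)
  fix x U
  assume x: "x \<in> X" "a x \<noteq> 0" "open U" "x \<in> U"
    and "\<not> 0 < total_variation (\<lambda>A. \<Sum>x\<in>X. a x * point_mass x A) U"
  then have "total_variation (\<lambda>A. \<Sum>x\<in>X. a x * point_mass x A) U \<le> 0" by simp
  moreover have "(\<Sum>B\<in>{{x}, U - {x}}. ennreal \<bar>\<Sum>x\<in>X. a x * point_mass x B\<bar>)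
      \<le> total_variation (\<lambda>A. \<Sum>x\<in>X. a x * point_mass x A) U"
    unfolding total_variation_def using x by (intro SUP_upper) (auto simp: disjoint_def)
  ultimately have "(\<Sum>B\<in>{{x}, U - {x}}. ennreal \<bar>\<Sum>x\<in>X. a x * point_mass x B\<bar>) = 0"
    using order_trans by fastforce
  then have "\<bar>\<Sum>y\<in>X. a y * point_mass y {x}\<bar> = 0" by (simp add: sum_nonneg_eq_0_iff)
  moreover have "(\<Sum>y\<in>X. a y * point_mass y {x}) = (\<Sum>y\<in>X. if y = x then a x else 0)"
    by (intro sum.cong) (auto simp: point_mass_def)
  ultimately show False using x assms by simp
qed

text \<open>The complement of a finite set is open here, and every Borel partition of it avoids all
  the atoms.\<close>

lemma signed_support_subset:
  fixes X :: "'a::t1_space set"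
  assumes "finite X"
  shows "signed_support (\<lambda>A. \<Sum>x\<in>X. a x * point_mass x A) \<subseteq> X"
proof (rule subsetI, rule ccontr)
  fix x assume x: "x \<in> signed_support (\<lambda>A. \<Sum>x\<in>X. a x * point_mass x A)" "x \<notin> X"
  have "open (- X)" using assms by (simp add: finite_imp_closed open_Compl)
  then have "0 < total_variation (\<lambda>A. \<Sum>x\<in>X. a x * point_mass x A) (- X)"
    using x by (simp add: signed_support_def)
  moreover have "total_variation (\<lambda>A. \<Sum>x\<in>X. a x * point_mass x A) (- X) \<le> 0"
    unfolding total_variation_def
  proof (rule SUP_least, clarify)
    fix P assume P: "\<Union>P = - X"
    have "(\<Sum>x\<in>X. a x * point_mass x B) = 0" if "B \<in> P" for B
      using P that by (intro sum.neutral) (auto simp: point_mass_def)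
    then show "(\<Sum>B\<in>P. ennreal \<bar>\<Sum>x\<in>X. a x * point_mass x B\<bar>) \<le> 0" by simp
  qed
  ultimately show False by simp
qed

text \<open>The explicit description of the cascade is proved on Borel sets only. This congruence
  and the next one transport it through notions that inspect nothing else.\<close>

lemma signed_integral_cong:
  assumes "\<And>A. A \<in> sets borel \<Longrightarrow> \<nu> A = \<nu>' A"
  shows "signed_integral \<nu> = signed_integral \<nu>'"
proof -
  have "upper_variation \<nu> = upper_variation \<nu>'" "upper_variation (\<lambda>A. - \<nu> A) = upper_variation (\<lambda>A. - \<nu>' A)"
    using assms by (simp_all add: upper_variation_def cong: SUP_cong_simp)
  then show ?thesis by (simp add: signed_integral_def fun_eq_iff)
qed

lemma total_variation_cong:
  assumes "\<And>A. A \<in> sets borel \<Longrightarrow> \<nu> A = \<nu>' A"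
  shows "total_variation \<nu> = total_variation \<nu>'"
  unfolding total_variation_def
  by (intro ext SUP_cong sum.cong) (auto simp: assms subset_eq)

section \<open>The cascade\<close>

text \<open>
  Both cases at once: the first assumption says that multiplication by \<open>c\<close> doubles volumes.
\<close>

locale orthonormal_cascade =
  fixes c :: "'a::{real_normed_field, euclidean_space}" and G :: "'a set" and p :: "'a \<Rightarrow> real"
  assumes doubling: "norm c ^ DIM('a) = 2"
    and zero_mem: "0 \<in> G"
    and diff_mem: "x \<in> G \<Longrightarrow> y \<in> G \<Longrightarrow> x - y \<in> G"
    and scale_mem: "x \<in> G \<Longrightarrow> c * x \<in> G"
    and discrete: "x \<in> G \<Longrightarrow> x \<noteq> 0 \<Longrightarrow> 1 \<le> norm x"
    and mask: "orthonormal_mask c G p"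
begin

abbreviation K :: "'a set" where "K \<equiv> mask_support G p"

lemma norm_c: "1 < norm c"
proof (rule ccontr)
  assume "\<not> 1 < norm c"
  then have "norm c ^ DIM('a) \<le> 1" by (simp add: power_le_one)
  with doubling show False by simp
qed

lemma c_nonzero [simp]: "c \<noteq> 0" "0 < norm c"
  using norm_c by auto

lemma add_mem: "x \<in> G \<Longrightarrow> y \<in> G \<Longrightarrow> x + y \<in> G"
  using diff_mem[of x "0 - y"] diff_mem[OF zero_mem, of y] by simp

lemma finite_K [simp]: "finite K"
  using mask by (simp add: orthonormal_mask_def)

lemma K_subset: "K \<subseteq> G"
  by (auto simp: mask_support_def)

lemma infsum_mask: "(\<Sum>\<^sub>\<infinity>k\<in>G. p k * f k) = (\<Sum>k\<in>K. p k * f k)"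
proof -
  have "(\<Sum>\<^sub>\<infinity>k\<in>G. p k * f k) = (\<Sum>\<^sub>\<infinity>k\<in>K. p k * f k)"
    by (rule infsum_cong_neutral) (auto simp: mask_support_def)
  then show ?thesis by simp
qed

lemma sum_mask: "(\<Sum>k\<in>K. p k) = 1"
  using mask infsum_mask[of "\<lambda>_. 1"] by (simp add: orthonormal_mask_def)

text \<open>The orthonormality condition as a double sum over the finite mask support, in the shape
  that arises when a correlation is expanded by one digit on each side.\<close>

lemma orthonormal:
  assumes i: "i \<in> G"
  shows "(\<Sum>k\<in>K. \<Sum>l\<in>K. p k * p l * (if c * i + k - l = 0 then 1 else 0)) = (if i = 0 then 1 / 2 else 0)"
proof -
  have "(\<Sum>l\<in>K. p k * p l * (if c * i + k - l = 0 then 1 else 0)) = p k * p (k + c * i)"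
    if "k \<in> K" for k
  proof -
    have "k + c * i \<in> G" using that K_subset i by (auto intro: add_mem scale_mem)
    moreover have "(\<Sum>l\<in>K. p k * p l * (if c * i + k - l = 0 then 1 else 0)) =
        (\<Sum>l\<in>K. if l = k + c * i then p k * p (k + c * i) else 0)"
      by (intro sum.cong) (auto simp: algebra_simps)
    moreover from \<open>k + c * i \<in> G\<close> have "p (k + c * i) = 0" if "k + c * i \<notin> K"
      using that by (auto simp: mask_support_def)
    ultimately show ?thesis by auto
  qed
  then show ?thesis
    using mask i by (simp add: orthonormal_mask_def infsum_mask cong: sum.cong)
qed

text \<open>Integration against the \<open>n\<close>-th measure of the cascade.\<close>

primrec casc :: "nat \<Rightarrow> ('a \<Rightarrow> real) \<Rightarrow> real" where
  "casc 0 f = f 0"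
| "casc (Suc n) f = (\<Sum>k\<in>K. p k * casc n (\<lambda>y. f ((k + y) / c)))"

text \<open>These are the digit sums, built by adding each new digit at the coarsest scale. A node
  can have weight 0 when contributions cancel.\<close>

primrec nodes :: "nat \<Rightarrow> 'a set" where
  "nodes 0 = {0}"
| "nodes (Suc n) = (\<lambda>(k, y). (k + y) / c) ` (K \<times> nodes n)"

text \<open>Several digit strings may lead to the same point; this is the total mass there, after
  all of them are merged.\<close>

definition weight :: "nat \<Rightarrow> 'a \<Rightarrow> real" where
  "weight n x = casc n (indicator {x})"

lemma finite_nodes [simp]: "finite (nodes n)"
  by (induction n) auto

lemma casc_cong: "(\<And>x. x \<in> nodes n \<Longrightarrow> f x = g x) \<Longrightarrow> casc n f = casc n g"
proof (induction n arbitrary: f g)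
  case (Suc n)
  then have "casc n (\<lambda>y. f ((k + y) / c)) = casc n (\<lambda>y. g ((k + y) / c))" if "k \<in> K" for k
    using that by (intro Suc.IH Suc.prems) auto
  then show ?case by (auto intro: sum.cong)
qed simp

lemma casc_sum: "casc n (\<lambda>x. \<Sum>i\<in>I. w i * f i x) = (\<Sum>i\<in>I. w i * casc n (f i))"
proof (induction n arbitrary: f)
  case (Suc n)
  have "casc (Suc n) (\<lambda>x. \<Sum>i\<in>I. w i * f i x) =
      (\<Sum>k\<in>K. \<Sum>i\<in>I. p k * (w i * casc n (\<lambda>y. f i ((k + y) / c))))"
    by (simp add: Suc sum_distrib_left)
  also have "\<dots> = (\<Sum>i\<in>I. w i * casc (Suc n) (f i))"
    by (subst sum.swap) (simp add: sum_distrib_left mult_ac)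
  finally show ?case .
qed simp

lemma casc_eq_sum: "casc n f = (\<Sum>x\<in>nodes n. weight n x * f x)"
proof -
  have "f y = (\<Sum>x\<in>nodes n. f x * indicator {x} y)" if "y \<in> nodes n" for y
  proof -
    have "(\<Sum>x\<in>nodes n. f x * indicator {x} y) = (\<Sum>x\<in>nodes n. if x = y then f y else 0)"
      by (intro sum.cong) auto
    then show ?thesis using that by simp
  qed
  then have "casc n f = casc n (\<lambda>y. \<Sum>x\<in>nodes n. f x * indicator {x} y)" by (rule casc_cong)
  also have "\<dots> = (\<Sum>x\<in>nodes n. f x * casc n (indicator {x}))" by (rule casc_sum)
  finally show ?thesis by (simp add: weight_def mult.commute)
qed

lemma casc_diff: "casc n (\<lambda>x. f x - g x) = casc n f - casc n g"
  by (simp add: casc_eq_sum right_diff_distrib sum_subtractf)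

lemma casc_one: "casc n (\<lambda>_. 1) = 1"
  by (induction n) (simp_all add: sum_mask)

section \<open>Identification of the cascade with its finite sums of point masses\<close>

lemma borel_vimage_affine: "A \<in> sets borel \<Longrightarrow> (\<lambda>y. x + y / c) -` A \<in> sets (borel :: 'a measure)"
  using measurable_sets[of "\<lambda>y. x + y / c" borel borel A]
  by (auto intro!: borel_measurable_continuous_onI continuous_intros)

text \<open>Convolving with the mask measure sums over the first digit \<open>k / c\<close>, and the
  push-forward divides the remaining digits by \<open>c\<close>: this is the recursion of
  \<open>casc\<close>. The dummy at index 0 is evaluation at 0, so the identity includes it.\<close>

lemma cascade_eq: "A \<in> sets borel \<Longrightarrow> cascade c G p n A = casc n (indicator A)"
proof (induction n arbitrary: A rule: induct_nat_012)
  case 0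
  then show ?case by (simp add: point_mass_def)
next
  case 1
  then show ?case by (simp add: mask_measure_def infsum_mask point_mass_def)
next
  case (ge2 n)
  note A = \<open>A \<in> sets borel\<close>
  have eq: "push_forward (\<lambda>x. x / c) (cascade c G p (Suc n)) ((\<lambda>y. x + y) -` A) =
      casc (Suc n) (\<lambda>y. indicator A (x + y / c))" for x
  proof -
    have "push_forward (\<lambda>x. x / c) (cascade c G p (Suc n)) ((\<lambda>y. x + y) -` A) =
        cascade c G p (Suc n) ((\<lambda>y. x + y / c) -` A)"
      by (simp add: push_forward_def vimage_def)
    also have "\<dots> = casc (Suc n) (indicator ((\<lambda>y. x + y / c) -` A))"
      by (intro ge2 borel_vimage_affine A)
    also have "indicator ((\<lambda>y. x + y / c) -` A) = (\<lambda>y. indicator A (x + y / c) :: real)"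
      by (auto simp: indicator_def)
    finally show ?thesis .
  qed
  \<comment> \<open>The inner integral must be a bounded Borel function of \<open>x\<close> before
    the outer one can be evaluated as a finite sum.\<close>
  have "bounded_borel (\<lambda>x. indicator A (x + y / c))" for y
  proof -
    have "(\<lambda>x. x + y / c) -` A \<in> sets borel"
      using measurable_sets[of "\<lambda>x. x + y / c" borel borel A] A
      by (auto intro!: borel_measurable_continuous_onI continuous_intros)
    then have "bounded_borel (indicator ((\<lambda>x. x + y / c) -` A))" by (rule bounded_borel_indicator)
    also have "indicator ((\<lambda>x. x + y / c) -` A) = (\<lambda>x. indicator A (x + y / c) :: real)"
      by (auto simp: indicator_def)
    finally show ?thesis .
  qed
  then have "bounded_borel (\<lambda>x. casc (Suc n) (\<lambda>y. indicator A (x + y / c)))"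
    unfolding casc_eq_sum by (intro bounded_borel_sum)
  then have "cascade c G p (Suc (Suc n)) A =
      (\<Sum>k\<in>K. p k * casc (Suc n) (\<lambda>y. indicator A (k / c + y / c)))"
    unfolding cascade.simps signed_convolution_def eq mask_measure_def infsum_mask
    by (rule signed_integral_combination[OF finite_K])
  also have "\<dots> = casc (Suc (Suc n)) (indicator A)"
    unfolding casc.simps(2)[of "Suc n"] add_divide_distrib ..
  finally show ?case .
qed

lemma cascade_eq_combination:
  "A \<in> sets borel \<Longrightarrow> cascade c G p n A = (\<Sum>x\<in>nodes n. weight n x * point_mass x A)"
  by (simp add: cascade_eq casc_eq_sum point_mass_def)

lemma signed_integral_cascade:
  assumes "bounded_borel f"
  shows "signed_integral (cascade c G p n) f = casc n f"
proof -
  have "signed_integral (cascade c G p n) =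
      signed_integral (\<lambda>A. \<Sum>x\<in>nodes n. weight n x * point_mass x A)"
    by (rule signed_integral_cong) (rule cascade_eq_combination)
  then show ?thesis using assms by (simp add: signed_integral_combination casc_eq_sum)
qed

lemma total_variation_cascade:
  "total_variation (cascade c G p n) =
    total_variation (\<lambda>A. \<Sum>x\<in>nodes n. weight n x * point_mass x A)"
  by (rule total_variation_cong) (rule cascade_eq_combination)

lemma tv_norm_cascade_le: "tv_norm (cascade c G p n) \<le> ennreal (\<Sum>x\<in>nodes n. \<bar>weight n x\<bar>)"
  unfolding tv_norm_def total_variation_cascade
  unfolding tv_norm_def[symmetric] by (rule tv_norm_combination_le) simp

lemma card_weight_le: "card {x \<in> nodes n. weight n x \<noteq> 0} \<le> card (signed_support (cascade c G p n))"
proof (rule card_mono)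
  have eq: "signed_support (cascade c G p n) = signed_support (\<lambda>A. \<Sum>x\<in>nodes n. weight n x * point_mass x A)"
    unfolding signed_support_def total_variation_cascade ..
  \<comment> \<open>\<open>card\<close> is 0 on infinite sets, so inclusion alone would not compare
    the cardinalities.\<close>
  show "finite (signed_support (cascade c G p n))"
    unfolding eq by (rule finite_subset[OF signed_support_subset]) auto
  show "{x \<in> nodes n. weight n x \<noteq> 0} \<subseteq> signed_support (cascade c G p n)"
    unfolding eq by (rule support_subset_signed_support) simp
qed

section \<open>Energy identity and total variation\<close>

text \<open>Splitting off the first digits \<open>k\<close> and \<open>l\<close> turns lag
  \<open>i\<close> at level \<open>Suc n\<close> into lag \<open>c * i + k - l\<close> at level
  \<open>n\<close>, again in \<open>G\<close>. By induction only lag 0 survives, with factor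
  \<open>1 / 2 ^ n\<close>, and the remaining double sum is the orthonormality condition.\<close>

lemma casc_correlation:
  "i \<in> G \<Longrightarrow> casc n (\<lambda>x. casc n (\<lambda>y. if y - x = i then 1 else 0)) = (if i = 0 then 1 / 2 ^ n else 0)"
proof (induction n arbitrary: i)
  case (Suc n)
  have shift: "(l + y) / c - (k + x) / c = i \<longleftrightarrow> y - x = c * i + k - l" for k l x y
  proof -
    have "(l + y) / c - (k + x) / c = i \<longleftrightarrow> (l + y) - (k + x) = i * c"
      by (simp add: divide_eq_eq flip: diff_divide_distrib)
    then show ?thesis by (auto simp: algebra_simps)
  qed
  have IH: "casc n (\<lambda>x. casc n (\<lambda>y. if y - x = c * i + k - l then 1 else 0)) =
      1 / 2 ^ n * (if c * i + k - l = 0 then 1 else 0)" if "k \<in> K" "l \<in> K" for k l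
    using that Suc.prems K_subset by (subst Suc.IH) (auto intro!: diff_mem add_mem scale_mem)
  have "casc (Suc n) (\<lambda>x. casc (Suc n) (\<lambda>y. if y - x = i then 1 else 0)) =
      (\<Sum>k\<in>K. p k * (\<Sum>l\<in>K. p l * casc n (\<lambda>x. casc n (\<lambda>y. if y - x = c * i + k - l then 1 else 0))))"
    by (simp add: shift casc_sum sum_distrib_left) (subst sum.swap, simp add: mult.left_commute)
  also have "\<dots> = (\<Sum>k\<in>K. p k * (\<Sum>l\<in>K. p l * (1 / 2 ^ n * (if c * i + k - l = 0 then 1 else 0))))"
    by (intro sum.cong refl arg_cong2[where f="(*)"] IH)
  also have "\<dots> = 1 / 2 ^ n * (\<Sum>k\<in>K. \<Sum>l\<in>K. p k * p l * (if c * i + k - l = 0 then 1 else 0))"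
    unfolding sum_distrib_left by (intro sum.cong refl) (simp only: mult_ac)
  also have "\<dots> = (if i = 0 then 1 / 2 ^ Suc n else 0)"
    unfolding orthonormal[OF Suc.prems] by simp
  finally show ?case .
qed simp

text \<open>At lag 0 only pairs of equal nodes contribute to the correlation, which leaves the
  squares of the merged masses.\<close>

lemma sum_weight_squares: "(\<Sum>x\<in>nodes n. (weight n x)\<^sup>2) = 1 / 2 ^ n"
proof -
  have "casc n (\<lambda>y. if y - x = 0 then 1 else 0) = weight n x" for x
    unfolding weight_def by (intro casc_cong) (auto simp: indicator_def)
  then have "casc n (weight n) = 1 / 2 ^ n"
    using casc_correlation[OF zero_mem, of n] by simp
  then show ?thesis by (simp add: casc_eq_sum power2_eq_square)
qed

text \<open>Cauchy-Schwarz against the constant 1, restricted to nodes of nonzero weight so that the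
  count can be compared with the support.\<close>

lemma sum_abs_weight_le:
  "(\<Sum>x\<in>nodes n. \<bar>weight n x\<bar>) \<le> sqrt (card {x \<in> nodes n. weight n x \<noteq> 0} / 2 ^ n)"
proof (rule real_le_rsqrt)
  let ?S = "{x \<in> nodes n. weight n x \<noteq> 0}"
  have "(\<Sum>x\<in>nodes n. \<bar>weight n x\<bar>) = (\<Sum>x\<in>?S. 1 * \<bar>weight n x\<bar>)"
    by (intro sum.mono_neutral_cong_right) auto
  then have "(\<Sum>x\<in>nodes n. \<bar>weight n x\<bar>)\<^sup>2 \<le> (\<Sum>x\<in>?S. 1\<^sup>2) * (\<Sum>x\<in>?S. \<bar>weight n x\<bar>\<^sup>2)"
    using Cauchy_Schwarz_ineq_sum[of "\<lambda>_. 1" "\<lambda>x. \<bar>weight n x\<bar>" ?S] by simp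
  also have "(\<Sum>x\<in>?S. \<bar>weight n x\<bar>\<^sup>2) = (\<Sum>x\<in>nodes n. (weight n x)\<^sup>2)"
    by (intro sum.mono_neutral_cong_left) auto
  finally show "(\<Sum>x\<in>nodes n. \<bar>weight n x\<bar>)\<^sup>2 \<le> card ?S / 2 ^ n"
    by (simp add: sum_weight_squares)
qed

section \<open>Packing of balls around the nodes\<close>

definition radius :: real where
  "radius = (\<Sum>k\<in>K. norm k) / (norm c - 1)"

text \<open>\<open>radius\<close> is the fixed point of \<open>r \<mapsto> (r + s) / norm c\<close>
  with \<open>s\<close> the sum of the norms of the digits, so its closed ball is mapped into itself
  by each \<open>y \<mapsto> (k + y) / c\<close>.\<close>

lemma norm_nodes: "x \<in> nodes n \<Longrightarrow> norm x \<le> radius"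
proof (induction n arbitrary: x)
  case 0
  then show ?case using norm_c by (simp add: radius_def sum_nonneg)
next
  case (Suc n)
  then obtain k y where ky: "k \<in> K" "y \<in> nodes n" "x = (k + y) / c" by auto
  have "norm k \<le> (\<Sum>k\<in>K. norm k)" using ky by (intro member_le_sum) auto
  then have "norm (k + y) \<le> radius * (norm c - 1) + radius"
    using norm_triangle_ineq[of k y] Suc.IH[OF ky(2)] norm_c by (simp add: radius_def)
  then show ?case using ky norm_c by (simp add: norm_divide divide_le_eq algebra_simps)
qed

lemma scaled_nodes: "x \<in> nodes n \<Longrightarrow> c ^ n * x \<in> G"
proof (induction n arbitrary: x)
  case (Suc n)
  then obtain k y where ky: "k \<in> K" "y \<in> nodes n" "x = (k + y) / c" by auto
  have pow: "c ^ m * z \<in> G" if "z \<in> G" for m z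
    using that by (induction m) (auto simp: mult.assoc intro: scale_mem)
  have "c * x = k + y" using ky by simp
  then have "c ^ Suc n * x = c ^ n * k + c ^ n * y"
    by (simp only: power_Suc2 mult.assoc distrib_left)
  moreover have "c ^ n * k \<in> G" using ky K_subset by (auto intro: pow)
  ultimately show ?case using Suc.IH[OF ky(2)] by (simp only: add_mem)
qed (simp add: zero_mem)

text \<open>Half of the least distance \<open>1 / norm c ^ n\<close> that distinct points of the
  scaled lattice can have.\<close>

definition cell_radius :: "nat \<Rightarrow> real" where
  "cell_radius n = 1 / (2 * norm c ^ n)"

abbreviation cell :: "nat \<Rightarrow> 'a \<Rightarrow> 'a set" where
  "cell n x \<equiv> ball x (cell_radius n)"

definition cell_volume :: real where
  "cell_volume = measure lborel (ball (0::'a) (1 / 2))"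

text \<open>The extra 1 leaves room for the cells, whose radii are at most 1/2.\<close>

definition region :: "'a set" where
  "region = cball 0 (radius + 1)"

lemma cell_radius: "0 < cell_radius n" "cell_radius n \<le> 1"
proof -
  have "1 \<le> norm c ^ n" using norm_c by (intro one_le_power) simp
  then show "cell_radius n \<le> 1" by (simp add: cell_radius_def divide_le_eq)
qed (simp add: cell_radius_def)

lemma cell_radius_tendsto: "cell_radius \<longlonglongrightarrow> 0"
proof -
  have "(\<lambda>n. 1 / 2 * (1 / norm c) ^ n) \<longlonglongrightarrow> 1 / 2 * 0"
    using norm_c by (intro tendsto_mult tendsto_const LIMSEQ_power_zero) simp
  then show ?thesis by (simp add: cell_radius_def[abs_def] power_divide)
qed

lemma cell_volume_pos: "0 < cell_volume"
  by (simp add: cell_volume_def)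

text \<open>Volume scales with the power \<open>DIM('a)\<close> of the radius, and
  \<open>doubling\<close> turns this into a factor 1/2 per level: the same rate at which the energy
  decays.\<close>

lemma measure_cell: "measure lborel (cell n x) = cell_volume / 2 ^ n"
proof -
  have "(norm c ^ n) ^ DIM('a) = 2 ^ n"
    by (metis doubling mult.commute power_mult)
  then have "(cell_radius n) ^ DIM('a) = (1 / 2) ^ DIM('a) / 2 ^ n"
    by (simp add: cell_radius_def power_divide power_mult_distrib)
  then show ?thesis using cell_radius[of n]
    by (simp add: cell_volume_def content_ball)
qed

lemma cell_subset_region: "x \<in> nodes n \<Longrightarrow> cell n x \<subseteq> region"
proof
  fix y assume "x \<in> nodes n" "y \<in> cell n x"
  then show "y \<in> region"
    using norm_nodes[of x n] cell_radius(2)[of n] norm_triangle_ineq2[of y x]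
    by (simp add: region_def dist_norm norm_minus_commute)
qed

text \<open>Multiplied by \<open>c ^ n\<close>, two nodes become lattice points, which differ by at
  least 1 in norm.\<close>

lemma disjoint_cells:
  assumes xy: "x \<in> nodes n" "y \<in> nodes n" "x \<noteq> y"
  shows "disjnt (cell n x) (cell n y)"
proof -
  have "c ^ n * x - c ^ n * y \<in> G" using xy by (intro diff_mem scaled_nodes)
  moreover have "c ^ n * x - c ^ n * y \<noteq> 0" using xy by simp
  ultimately have "1 \<le> norm (c ^ n * x - c ^ n * y)" by (rule discrete)
  also have "\<dots> = norm c ^ n * dist x y"
    by (simp add: dist_norm norm_mult norm_power flip: right_diff_distrib)
  finally have "2 * cell_radius n \<le> dist x y"
    by (simp add: cell_radius_def divide_le_eq mult.commute)
  then show ?thesis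
    unfolding disjnt_def by (intro disjoint_ballI) simp
qed

lemma region_fmeasurable [simp]: "region \<in> fmeasurable lborel"
  unfolding region_def by (intro fmeasurable_compact compact_cball)

text \<open>Disjointness of the cells makes their volumes add up inside \<open>region\<close>. With
  \<open>A = UNIV\<close> this counts the nodes; for general \<open>A\<close> it drives the estimate
  of smoothed masses.\<close>

lemma sum_measure_cells_le:
  assumes A: "A \<in> sets borel"
  shows "(\<Sum>x\<in>nodes n. measure lborel (cell n x \<inter> A)) \<le> measure lborel (A \<inter> region)"
proof -
  have fm: "A \<inter> region \<in> fmeasurable lborel"
    using fmeasurable_Int_fmeasurable[OF region_fmeasurable, of A] A by (simp add: Int_commute)
  have cell: "cell n x \<inter> A \<in> fmeasurable lborel" if "x \<in> nodes n" for x
    using cell_subset_region[OF that] A by (intro fmeasurableI2[OF fm]) auto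
  have "(\<Sum>x\<in>nodes n. measure lborel (cell n x \<inter> A)) = measure lborel (\<Union>x\<in>nodes n. cell n x \<inter> A)"
  proof (rule measure_UNION'[symmetric])
    show "pairwise (\<lambda>x y. disjnt (cell n x \<inter> A) (cell n y \<inter> A)) (nodes n)"
      using disjoint_cells by (fastforce simp: pairwise_def disjnt_def)
  qed (use cell in auto)
  also have "\<dots> \<le> measure lborel (A \<inter> region)"
  proof (rule measure_mono_fmeasurable[OF _ _ fm])
    show "(\<Union>x\<in>nodes n. cell n x \<inter> A) \<in> sets lborel"
      using A by (intro sets.finite_UN) auto
  qed (use cell_subset_region in auto)
  finally show ?thesis .
qed

definition tv_bound :: real where
  "tv_bound = sqrt (measure lborel region / cell_volume)"

lemma sum_abs_weight_le_tv_bound: "(\<Sum>x\<in>nodes n. \<bar>weight n x\<bar>) \<le> tv_bound"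
proof -
  have "card (nodes n) * (cell_volume / 2 ^ n) \<le> measure lborel region"
    using sum_measure_cells_le[of UNIV n] by (simp add: measure_cell)
  then have "card (nodes n) / 2 ^ n \<le> measure lborel region / cell_volume"
    using cell_volume_pos by (simp add: field_simps)
  moreover have "card {x \<in> nodes n. weight n x \<noteq> 0} \<le> card (nodes n)"
    by (intro card_mono) auto
  ultimately have "card {x \<in> nodes n. weight n x \<noteq> 0} / 2 ^ n \<le> measure lborel region / cell_volume"
    by (meson divide_right_mono of_nat_mono order_trans zero_le_numeral zero_le_power)
  then show ?thesis
    unfolding tv_bound_def by (intro order_trans[OF sum_abs_weight_le] real_sqrt_le_mono)
qed

lemma tv_norm_cascade_bounded: "tv_norm (cascade c G p n) \<le> ennreal tv_bound"
  by (intro order_trans[OF tv_norm_cascade_le] ennreal_leI sum_abs_weight_le_tv_bound)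

text \<open>The chain of inequalities bounds the number of nonzero atoms by
  \<open>N * 2 ^ n\<close>, and the factor \<open>2 ^ n\<close> cancels against the energy.\<close>

lemma tv_norm_cascade_le_sqrt:
  assumes "cardinality_bound c G p N" "1 \<le> n"
  shows "tv_norm (cascade c G p n) \<le> ennreal (sqrt N)"
proof -
  have "real (card {x \<in> nodes n. weight n x \<noteq> 0}) \<le> N * 2 ^ n"
    using assms card_weight_le[of n] unfolding cardinality_bound_def
    by (meson of_nat_mono order_trans)
  then have "card {x \<in> nodes n. weight n x \<noteq> 0} / 2 ^ n \<le> N" by (simp add: divide_le_eq)
  then show ?thesis
    by (intro order_trans[OF tv_norm_cascade_le] ennreal_leI order_trans[OF sum_abs_weight_le]
        real_sqrt_le_mono)
qed

end

section \<open>Convergence on Lipschitz functions\<close>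

context orthonormal_cascade
begin

lemma tv_bound_nonneg: "0 \<le> tv_bound"
  using cell_volume_pos by (simp add: tv_bound_def)

text \<open>
  With the new digit at the finest scale, consecutive measures differ by translations of
  size \<open>norm c\<close> to the \<open>-(n + 1)\<close>.
\<close>

lemma casc_refine: "casc (Suc n) f = (\<Sum>k\<in>K. p k * casc n (\<lambda>y. f (y + k / c ^ Suc n)))"
proof (induction n arbitrary: f)
  case (Suc n)
  have "casc (Suc (Suc n)) f =
      (\<Sum>k\<in>K. p k * (\<Sum>j\<in>K. p j * casc n (\<lambda>y. f ((k + (y + j / c ^ Suc n)) / c))))"
    unfolding casc.simps(2)[of "Suc n"] Suc ..
  also have "\<dots> = (\<Sum>j\<in>K. p j * (\<Sum>k\<in>K. p k * casc n (\<lambda>y. f ((k + y) / c + j / c ^ Suc (Suc n)))))"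
    unfolding sum_distrib_left
    by (subst sum.swap) (simp add: add_divide_distrib add.assoc mult.left_commute mult.commute)
  finally show ?case by simp
qed simp

lemma casc_abs_le:
  assumes "\<And>x. x \<in> nodes n \<Longrightarrow> \<bar>f x\<bar> \<le> e" "0 \<le> e"
  shows "\<bar>casc n f\<bar> \<le> tv_bound * e"
proof -
  have "\<bar>casc n f\<bar> \<le> (\<Sum>x\<in>nodes n. \<bar>weight n x\<bar> * e)"
    unfolding casc_eq_sum using assms
    by (intro order_trans[OF sum_abs] sum_mono) (simp add: abs_mult mult_left_mono)
  also have "\<dots> \<le> tv_bound * e"
    unfolding sum_distrib_right[symmetric]
    by (intro mult_right_mono sum_abs_weight_le_tv_bound assms)
  finally show ?thesis .
qed

text \<open>The last digit moves each atom by an amount of order \<open>1 / norm c ^ Suc n\<close>.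
  With the uniform bound on the total variation, consecutive differences are dominated by a
  geometric series and the telescoping sum converges.\<close>

lemma convergent_casc_lipschitz:
  assumes lip: "B-lipschitz_on UNIV g"
  shows "convergent (\<lambda>n. casc n g)"
proof -
  define C where "C = (\<Sum>k\<in>K. \<bar>p k\<bar> * (tv_bound * (B * norm k)))"
  have B: "0 \<le> B" using lip by (rule lipschitz_on_nonneg)
  have step: "norm (casc (Suc n) g - casc n g) \<le> C * (1 / norm c) ^ n" for n
  proof -
    \<comment> \<open>As the mask sums to 1, the old value can be averaged with the same
      coefficients and subtracted digit by digit.\<close>
    have "casc n g = (\<Sum>k\<in>K. p k * casc n g)"
      by (simp add: sum_mask flip: sum_distrib_right)
    then have "casc (Suc n) g - casc n g =
        (\<Sum>k\<in>K. p k * casc n (\<lambda>y. g (y + k / c ^ Suc n) - g y))"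
      by (simp add: casc_refine casc_diff right_diff_distrib sum_subtractf del: casc.simps)
    also have "\<bar>\<dots>\<bar> \<le> (\<Sum>k\<in>K. \<bar>p k\<bar> * (tv_bound * (B * norm k)) * (1 / norm c) ^ n)"
    proof (intro order_trans[OF sum_abs] sum_mono)
      fix k assume "k \<in> K"
      have small: "\<bar>g (y + k / c ^ Suc n) - g y\<bar> \<le> B * norm k * (1 / norm c) ^ n" for y
      proof -
        have "\<bar>g (y + k / c ^ Suc n) - g y\<bar> \<le> B * norm (k / c ^ Suc n)"
          using lipschitz_onD[OF lip, of "y + k / c ^ Suc n" y] by (simp add: dist_norm)
        also have "norm (k / c ^ Suc n) \<le> norm k * (1 / norm c) ^ n"
        proof -
          have "norm k * 1 \<le> norm k * norm c" using norm_c by (intro mult_left_mono) auto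
          then show ?thesis using norm_c
            by (simp add: norm_divide norm_mult norm_power power_divide field_simps)
        qed
        finally show ?thesis using B by (simp add: mult_left_mono mult.assoc)
      qed
      have "\<bar>casc n (\<lambda>y. g (y + k / c ^ Suc n) - g y)\<bar> \<le> tv_bound * (B * norm k * (1 / norm c) ^ n)"
        using B by (intro casc_abs_le small) auto
      then show "\<bar>p k * casc n (\<lambda>y. g (y + k / c ^ Suc n) - g y)\<bar>
          \<le> \<bar>p k\<bar> * (tv_bound * (B * norm k)) * (1 / norm c) ^ n"
        by (simp add: abs_mult mult_left_mono mult.assoc)
    qed
    finally show ?thesis by (simp add: C_def sum_distrib_right)
  qed
  have "summable (\<lambda>n. C * (1 / norm c) ^ n)"
    using norm_c by (intro summable_mult summable_geometric) simp
  then have "summable (\<lambda>n. casc (Suc n) g - casc n g)"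
    by (rule summable_comparison_test'[where N=0]) (rule step)
  then have "convergent (\<lambda>n. \<Sum>i<n. casc (Suc i) g - casc i g)"
    by (simp add: summable_iff_convergent)
  then have "convergent (\<lambda>n. casc n g - casc 0 g)"
    by (subst (asm) sum_lessThan_telescope)
  then show ?thesis by (simp only: convergent_diff_const_right_iff)
qed

section \<open>Spreading the atoms over balls\<close>

text \<open>
  Each atom of the \<open>n\<close>-th measure is spread uniformly over a ball of volume proportional to
  \<open>2\<close> to the \<open>-n\<close>. By the energy identity the resulting densities are bounded in \<open>L\<^sup>2\<close>, and this makes
  the values on every Borel set converge, which fails for the discrete measures themselves.
\<close>

definition spread :: "nat \<Rightarrow> 'a \<Rightarrow> 'a measure" where
  "spread n x = uniform_measure lborel (cell n x)"

definition smooth :: "nat \<Rightarrow> ('a \<Rightarrow> real) \<Rightarrow> real" where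
  "smooth n f = (\<Sum>x\<in>nodes n. weight n x * integral\<^sup>L (spread n x) f)"

lemma emeasure_cell: "emeasure lborel (cell n x) \<noteq> 0" "emeasure lborel (cell n x) \<noteq> \<infinity>"
proof -
  have "measure lborel (cell n x) \<noteq> 0" using cell_volume_pos by (simp add: measure_cell)
  then show "emeasure lborel (cell n x) \<noteq> 0" by (auto simp: measure_def)
qed (use emeasure_lborel_ball_finite[of x "cell_radius n"] in simp)

lemma prob_space_spread: "prob_space (spread n x)"
  unfolding spread_def by (rule prob_space_uniform_measure[OF emeasure_cell])

lemma sets_spread [simp]: "sets (spread n x) = sets borel"
  by (simp add: spread_def)

lemma space_spread [simp]: "space (spread n x) = UNIV"
  by (simp add: spread_def)

lemma finite_measure_spread: "finite_measure (spread n x)"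
  using prob_space_spread by (rule prob_space.axioms(1))

lemma measure_spread:
  "A \<in> sets borel \<Longrightarrow> measure (spread n x) A = measure lborel (cell n x \<inter> A) * 2 ^ n / cell_volume"
  unfolding spread_def by (subst measure_uniform_measure[OF emeasure_cell]) (auto simp: measure_cell)

lemma bounded_functional_spread: "bounded_functional 1 (integral\<^sup>L (spread n x))"
  using bounded_functional_integral[OF finite_measure_spread sets_spread, of n x]
    prob_space.prob_space[OF prob_space_spread, of n x] by simp

lemma bounded_functional_smooth: "bounded_functional tv_bound (smooth n)"
  unfolding smooth_def
  by (intro bounded_functional_mono[OF bounded_functional_combination]
      bounded_functional_spread sum_abs_weight_le_tv_bound)

text \<open>In Cauchy-Schwarz the weights contribute the energy \<open>1 / 2 ^ n\<close>, while each
  ball mass is at most 1 and so bounds its own square. Normalising the cells brings in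
  \<open>2 ^ n\<close>, which cancels the energy and leaves the packing bound.\<close>

lemma smooth_le_sqrt:
  assumes f: "bounded_borel f" and D: "D \<in> sets borel" and fD: "\<And>x. \<bar>f x\<bar> \<le> indicator D x"
  shows "\<bar>smooth n f\<bar> \<le> sqrt (measure lborel (D \<inter> region) / cell_volume)"
proof (rule real_le_rsqrt)
  let ?w = "\<lambda>x. measure (spread n x) D"
  have le: "\<bar>integral\<^sup>L (spread n x) f\<bar> \<le> ?w x" for x
  proof -
    have "\<bar>integral\<^sup>L (spread n x) f\<bar> \<le> (\<integral>y. \<bar>f y\<bar> \<partial>spread n x)" by (rule integral_abs_bound)
    also have "\<dots> \<le> (\<integral>y. indicator D y \<partial>spread n x)"
      using fD D f
      by (intro integral_mono integrable_abs finite_measure_integrable_bounded_borel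
          finite_measure_spread bounded_borel_indicator) auto
    finally show ?thesis using D by simp
  qed
  have w: "(?w x)\<^sup>2 \<le> ?w x" for x
    using prob_space.prob_le_1[OF prob_space_spread, of n x D]
    by (simp add: power2_eq_square mult_left_le)
  have "\<bar>smooth n f\<bar> \<le> (\<Sum>x\<in>nodes n. \<bar>weight n x\<bar> * ?w x)"
    unfolding smooth_def
    by (intro order_trans[OF sum_abs] sum_mono) (simp add: abs_mult mult_left_mono le)
  then have "\<bar>smooth n f\<bar>\<^sup>2 \<le> (\<Sum>x\<in>nodes n. \<bar>weight n x\<bar> * ?w x)\<^sup>2"
    by (intro power_mono) auto
  also have "\<dots> \<le> (\<Sum>x\<in>nodes n. \<bar>weight n x\<bar>\<^sup>2) * (\<Sum>x\<in>nodes n. (?w x)\<^sup>2)"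
    by (rule Cauchy_Schwarz_ineq_sum)
  also have "\<dots> \<le> 1 / 2 ^ n * (\<Sum>x\<in>nodes n. ?w x)"
    by (simp only: power2_abs sum_weight_squares) (intro mult_left_mono sum_mono w, simp)
  also have "\<dots> = (\<Sum>x\<in>nodes n. measure lborel (cell n x \<inter> D)) / cell_volume"
    using D by (simp add: measure_spread sum_distrib_left sum_divide_distrib)
  also have "\<dots> \<le> measure lborel (D \<inter> region) / cell_volume"
    using cell_volume_pos D by (intro divide_right_mono sum_measure_cells_le) auto
  finally show "\<bar>smooth n f\<bar>\<^sup>2 \<le> measure lborel (D \<inter> region) / cell_volume" .
qed

lemma bounded_borel_continuous:
  "continuous_on UNIV f \<Longrightarrow> bounded (range f) \<Longrightarrow> bounded_borel (f :: 'a \<Rightarrow> real)"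
  by (auto simp: bounded_borel_def bounded_iff borel_measurable_continuous_onI)

text \<open>Averaging over a cell changes \<open>f\<close> by at most its oscillation there. Uniform
  continuity on the compact \<open>region\<close> makes this small for all nodes at once, and
  \<open>tv_bound\<close> controls the sum.\<close>

lemma smooth_minus_casc_tendsto:
  assumes cont: "continuous_on UNIV f" and bd: "bounded (range f)"
  shows "(\<lambda>n. smooth n f - casc n f) \<longlonglongrightarrow> 0"
proof (rule LIMSEQ_I)
  fix r :: real assume r: "r > 0"
  define e where "e = r / (tv_bound + 1)"
  have e: "e > 0" "tv_bound * e < r"
    using r tv_bound_nonneg by (auto simp: e_def field_simps)
  have f: "bounded_borel f" using cont bd by (rule bounded_borel_continuous)
  have "uniformly_continuous_on region f"
    unfolding region_def
    by (intro compact_uniformly_continuous compact_cball continuous_on_subset[OF cont]) auto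
  then obtain d where d: "d > 0"
    "\<And>x y. x \<in> region \<Longrightarrow> y \<in> region \<Longrightarrow> dist y x < d \<Longrightarrow> dist (f y) (f x) < e"
    using e(1) unfolding uniformly_continuous_on_def by blast
  obtain m where m: "\<And>n. n \<ge> m \<Longrightarrow> cell_radius n < d"
    using LIMSEQ_D[OF cell_radius_tendsto d(1)] by fastforce
  have "norm (smooth n f - casc n f - 0) < r" if "n \<ge> m" for n
  proof -
    have avg: "\<bar>integral\<^sup>L (spread n x) f - f x\<bar> \<le> e" if x: "x \<in> nodes n" for x
    proof -
      interpret prob_space "spread n x" by (rule prob_space_spread)
      have int: "integrable (spread n x) h" if "bounded_borel h" for h
        using that by (intro finite_measure_integrable_bounded_borel finite_measure_spread) auto
      have "x \<in> region" using cell_subset_region[OF x] cell_radius(1) by force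
      then have "\<bar>f y - f x\<bar> \<le> e" if "y \<in> cell n x" for y
        using d(2)[of x y] that cell_subset_region[OF x] m[OF \<open>n \<ge> m\<close>]
        by (auto simp: dist_real_def dist_commute intro!: less_imp_le)
      \<comment> \<open>The oscillation bound is known on the cell only; the uniform measure does
        not charge its complement.\<close>
      then have ae: "AE y in spread n x. \<bar>f y - f x\<bar> \<le> e"
        unfolding spread_def by (intro AE_uniform_measureI) auto
      have df: "bounded_borel (\<lambda>y. f y - f x)" by (intro bounded_borel_diff f bounded_borel_const)
      have "integral\<^sup>L (spread n x) f - f x = (\<integral>y. f y - f x \<partial>spread n x)"
        using int[OF f] prob_space by (simp add: Bochner_Integration.integral_diff)
      also have "\<bar>\<dots>\<bar> \<le> (\<integral>y. \<bar>f y - f x\<bar> \<partial>spread n x)" by (rule integral_abs_bound)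
      also have "\<dots> \<le> (\<integral>y. e \<partial>spread n x)"
        using int[OF df] ae by (intro integral_mono_AE integrable_abs) auto
      finally show ?thesis using prob_space by simp
    qed
    have "smooth n f - casc n f = casc n (\<lambda>x. integral\<^sup>L (spread n x) f - f x)"
      by (simp add: smooth_def casc_eq_sum right_diff_distrib sum_subtractf)
    also have "\<bar>\<dots>\<bar> \<le> tv_bound * e" using avg e by (intro casc_abs_le) auto
    finally show ?thesis using e by simp
  qed
  then show "\<exists>no. \<forall>n\<ge>no. norm (smooth n f - casc n f - 0) < r" by blast
qed

text \<open>Regularity squeezes \<open>A\<close>, inside \<open>region\<close>, between a compact
  \<open>S\<close> and an open \<open>U\<close>. These have positive distance from \<open>S\<close>
  to the complement of \<open>U\<close>, so a cutoff in the distance to \<open>S\<close> is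
  Lipschitz, equal to 1 on \<open>S\<close> and to 0 off \<open>U\<close>.\<close>

lemma lipschitz_approximation:
  assumes A: "A \<in> sets borel" and e: "e > 0"
  obtains g :: "'a \<Rightarrow> real" and B D where
    "B-lipschitz_on UNIV g" "\<And>x. 0 \<le> g x" "\<And>x. g x \<le> 1" "D \<in> sets borel"
    "\<And>x. \<bar>indicator A x - g x\<bar> \<le> indicator D x" "measure lborel (D \<inter> region) < e"
proof -
  have e2: "e / 2 > 0" using e by simp
  obtain U where U: "open U" "A \<subseteq> U" "emeasure lborel (U - A) < ennreal (e / 2)"
    using outer_regular_lborel[OF A e2] by blast
  have "- A \<in> sets borel" using A by auto
  then obtain V where V: "open V" "- A \<subseteq> V" "emeasure lborel (V - - A) < ennreal (e / 2)"
    using outer_regular_lborel[OF _ e2] by blast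
  \<comment> \<open>Since \<open>V\<close> covers the complement of \<open>A\<close>, removing it
    gives a set inside \<open>A\<close>: outer regularity of the complement serves as inner
    regularity.\<close>
  define S where "S = region - V"
  have S: "compact S" "S \<subseteq> A"
    using V by (auto simp: S_def region_def Diff_eq intro!: compact_Int_closed)
  have "S \<inter> - U = {}" using S U by auto
  then obtain d where d: "d > 0" "\<And>x y. x \<in> S \<Longrightarrow> y \<in> - U \<Longrightarrow> d \<le> dist x y"
    using separate_compact_closed[OF S(1), of "- U"] U(1) by (auto simp: closed_Compl)
  \<comment> \<open>The exceptional set takes in everything outside \<open>region\<close> at no
    cost, as only its volume inside \<open>region\<close> is estimated.\<close>
  define D where "D = (U - A) \<union> (V - - A) \<union> - region"
  have UV: "U - A \<in> sets borel" "V - - A \<in> sets borel" using A U(1) V(1) by auto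
  have rb: "region \<in> sets borel" by (simp add: region_def)
  have D: "D \<in> sets borel" unfolding D_def using UV rb by auto
  have small: "measure lborel (D \<inter> region) < e"
  proof -
    have fm: "U - A \<in> fmeasurable lborel" "V - - A \<in> fmeasurable lborel"
      using U(3) V(3) UV by (auto intro!: fmeasurableI intro: less_trans)
    have lt: "measure lborel (U - A) < e / 2" "measure lborel (V - - A) < e / 2"
      using U(3) V(3) e2 fm
      by (simp_all add: emeasure_eq_measure2 ennreal_less_iff)
    have "measure lborel (D \<inter> region) \<le> measure lborel ((U - A) \<union> (V - - A))"
      using fm D rb by (intro measure_mono_fmeasurable fmeasurable.Un) (auto simp: D_def)
    also have "\<dots> \<le> measure lborel (U - A) + measure lborel (V - - A)"
      using UV by (intro measure_Un_le) auto
    finally show ?thesis using lt by simp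
  qed
  \<comment> \<open>\<open>infdist\<close> to the empty set is 0, which would make the cutoff
    constantly 1; hence the separate case.\<close>
  define g :: "'a \<Rightarrow> real" where
    "g x = (if S = {} then 0 else max 0 (1 - infdist x S / d))" for x
  have lip: "(1 / d)-lipschitz_on UNIV g"
  proof (rule lipschitz_onI)
    fix x y
    have "\<bar>max 0 (1 - infdist x S / d) - max 0 (1 - infdist y S / d)\<bar> \<le> \<bar>infdist x S / d - infdist y S / d\<bar>"
      by linarith
    also have "\<dots> = \<bar>infdist x S - infdist y S\<bar> / d" using d by (simp flip: diff_divide_distrib)
    also have "\<dots> \<le> dist x y / d" using d by (intro divide_right_mono infdist_triangle_abs) auto
    finally show "dist (g x) (g y) \<le> 1 / d * dist x y"
      using d by (auto simp: g_def dist_real_def)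
  qed (use d in simp)
  have bounds: "0 \<le> g x" "g x \<le> 1" for x
    using d by (auto simp: g_def infdist_nonneg)
  have "\<bar>indicator A x - g x\<bar> \<le> indicator D x" for x
  proof (cases "x \<in> D")
    case True
    then show ?thesis using bounds[of x] by (simp add: indicator_def)
  next
    case False
    then have x: "x \<in> region" "x \<in> U \<Longrightarrow> x \<in> A" "x \<in> V \<Longrightarrow> x \<notin> A" by (auto simp: D_def)
    show ?thesis
    proof (cases "x \<in> A")
      case True
      then have "x \<in> S" using x by (auto simp: S_def)
      then show ?thesis using True by (auto simp: g_def)
    next
      case notA: False
      have "g x = 0"
      proof (cases "S = {}")
        case False
        obtain s where s: "s \<in> S" "infdist x S = dist x s"
          using infdist_attains_inf[OF compact_imp_closed[OF S(1)] False] by blast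
        have "x \<in> - U" using notA x by auto
        then have "d \<le> infdist x S" using d(2) s by (simp add: dist_commute)
        then show ?thesis using d by (simp add: g_def le_divide_eq)
      qed (simp add: g_def)
      then show ?thesis using notA by simp
    qed
  qed
  then show ?thesis using that lip bounds D small by blast
qed

lemma convergent_smooth_indicator:
  assumes A: "A \<in> sets borel"
  shows "convergent (\<lambda>n. smooth n (indicator A))"
proof (rule Cauchy_convergent, rule CauchyI)
  fix r :: real assume r: "r > 0"
  \<comment> \<open>Chosen so that the square-root estimate for an exceptional set of volume below
    \<open>e\<close> yields \<open>r / 3\<close>.\<close>
  define e where "e = (r / 3)\<^sup>2 * cell_volume"
  have e: "e > 0" using r cell_volume_pos by (simp add: e_def)
  obtain g :: "'a \<Rightarrow> real" and B D where g: "B-lipschitz_on UNIV g" "\<And>x. 0 \<le> g x" "\<And>x. g x \<le> 1"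
    and D: "D \<in> sets borel" "\<And>x. \<bar>indicator A x - g x\<bar> \<le> indicator D x"
      "measure lborel (D \<inter> region) < e"
    by (rule lipschitz_approximation[OF A e]) blast
  have cont: "continuous_on UNIV g" using g(1) by (rule lipschitz_on_continuous_on)
  have bd: "bounded (range g)" using g(2,3) by (intro boundedI[of _ 1]) auto
  have gb: "bounded_borel g" using cont bd by (rule bounded_borel_continuous)
  have Ab: "bounded_borel (indicator A)" using A by (rule bounded_borel_indicator)
  have close: "\<bar>smooth n (indicator A) - smooth n g\<bar> \<le> r / 3" for n
  proof -
    have "\<bar>smooth n (\<lambda>x. indicator A x - g x)\<bar> \<le> sqrt (measure lborel (D \<inter> region) / cell_volume)"
      by (rule smooth_le_sqrt[OF bounded_borel_diff[OF Ab gb] D(1,2)])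
    also have "\<dots> \<le> sqrt ((r / 3)\<^sup>2)"
      using D(3) cell_volume_pos by (intro real_sqrt_le_mono) (simp add: e_def divide_le_eq)
    finally show ?thesis
      using r bounded_functional_diff[OF bounded_functional_smooth Ab gb] by simp
  qed
  have "convergent (\<lambda>n. (smooth n g - casc n g) + casc n g)"
    using smooth_minus_casc_tendsto[OF cont bd] convergent_casc_lipschitz[OF g(1)]
    by (intro convergent_add) (auto simp: convergent_def)
  then have "Cauchy (\<lambda>n. smooth n g)" by (simp add: convergent_Cauchy)
  then obtain M where M: "\<And>m n. m \<ge> M \<Longrightarrow> n \<ge> M \<Longrightarrow> norm (smooth m g - smooth n g) < r / 3"
    using r CauchyD[of "\<lambda>n. smooth n g" "r / 3"] by fastforce
  have "norm (smooth m (indicator A) - smooth n (indicator A)) < r" if "m \<ge> M" "n \<ge> M" for m n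
    using M[OF that] close[of m] close[of n] unfolding real_norm_def by linarith
  then show "\<exists>M. \<forall>m\<ge>M. \<forall>n\<ge>M. norm (smooth m (indicator A) - smooth n (indicator A)) < r" by blast
qed

section \<open>The limit measure\<close>

definition limit_measure :: "'a set \<Rightarrow> real" where
  "limit_measure A = lim (\<lambda>n. smooth n (indicator A))"

lemma smooth_tendsto_limit_measure:
  "A \<in> sets borel \<Longrightarrow> (\<lambda>n. smooth n (indicator A)) \<longlonglongrightarrow> limit_measure A"
  unfolding limit_measure_def by (rule convergent_LIMSEQ_iff[THEN iffD1]) (rule convergent_smooth_indicator)

text \<open>The bound is uniform in \<open>n\<close> and survives the limit. It is a quantitative
  absolute continuity with respect to Lebesgue measure.\<close>

lemma limit_measure_le_sqrt:
  assumes "A \<in> sets borel"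
  shows "\<bar>limit_measure A\<bar> \<le> sqrt (measure lborel (A \<inter> region) / cell_volume)"
proof (rule LIMSEQ_le_const2)
  show "(\<lambda>n. \<bar>smooth n (indicator A)\<bar>) \<longlonglongrightarrow> \<bar>limit_measure A\<bar>"
    using smooth_tendsto_limit_measure[OF assms] by (rule tendsto_rabs)
  show "\<exists>N. \<forall>n\<ge>N. \<bar>smooth n (indicator A)\<bar> \<le> sqrt (measure lborel (A \<inter> region) / cell_volume)"
    using assms by (intro exI allI impI smooth_le_sqrt bounded_borel_indicator) auto
qed

lemma limit_measure_Un:
  assumes A: "A \<in> sets borel" and B: "B \<in> sets borel" and disj: "A \<inter> B = {}"
  shows "limit_measure (A \<union> B) = limit_measure A + limit_measure B"
proof -
  have "indicator (A \<union> B) = (\<lambda>x. indicator A x + 1 * indicator B x :: real)"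
    using disj by (auto simp: indicator_def fun_eq_iff)
  then have "smooth n (indicator (A \<union> B)) = smooth n (indicator A) + smooth n (indicator B)" for n
    using bounded_functional_add_scale[OF bounded_functional_smooth, of "indicator A" "indicator B" n 1]
      bounded_borel_indicator[OF A] bounded_borel_indicator[OF B] by simp
  then have "(\<lambda>n. smooth n (indicator (A \<union> B))) \<longlonglongrightarrow> limit_measure A + limit_measure B"
    using tendsto_add[OF smooth_tendsto_limit_measure[OF A] smooth_tendsto_limit_measure[OF B]] by simp
  moreover have "(\<lambda>n. smooth n (indicator (A \<union> B))) \<longlonglongrightarrow> limit_measure (A \<union> B)"
    using A B by (intro smooth_tendsto_limit_measure) auto
  ultimately show ?thesis using LIMSEQ_unique by blast
qed

lemma finite_signed_measure_limit: "finite_signed_measure limit_measure"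
  unfolding finite_signed_measure_def
proof (intro conjI allI impI)
  show empty: "limit_measure {} = 0" using limit_measure_le_sqrt[of "{}"] by simp
  fix A :: "nat \<Rightarrow> 'a set"
  assume "range A \<subseteq> sets borel \<and> disjoint_family A"
  then have A: "\<And>i. A i \<in> sets borel" and disj: "disjoint_family A" by auto
  \<comment> \<open>The remainders decrease to the empty set, so their volumes in
    \<open>region\<close> tend to 0, and by the square-root bound so do their masses. Finite
    additivity then becomes countable additivity.\<close>
  define R where "R n = (\<Union>i. A i) - (\<Union>i<n. A i)" for n
  have Rb: "R n \<in> sets borel" for n unfolding R_def using A by auto
  have partial: "(\<Sum>i<n. limit_measure (A i)) = limit_measure (\<Union>i<n. A i)" for n
  proof (induction n)
    case (Suc n)
    have "A i \<inter> A n = {}" if "i < n" for i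
      by (rule disjoint_family_onD[OF disj]) (use that in auto)
    then have "limit_measure ((\<Union>i<n. A i) \<union> A n) = limit_measure (\<Union>i<n. A i) + limit_measure (A n)"
      using A by (intro limit_measure_Un) auto
    then show ?case using Suc by (simp add: lessThan_Suc Un_commute)
  qed (simp add: empty)
  have diff: "limit_measure (\<Union>i. A i) - (\<Sum>i<n. limit_measure (A i)) = limit_measure (R n)" for n
  proof -
    have "limit_measure ((\<Union>i<n. A i) \<union> R n) = limit_measure (\<Union>i<n. A i) + limit_measure (R n)"
      using A Rb by (intro limit_measure_Un) (auto simp: R_def)
    moreover have "(\<Union>i<n. A i) \<union> R n = (\<Union>i. A i)" by (auto simp: R_def)
    ultimately show ?thesis by (simp add: partial)
  qed
  have "(\<lambda>n. measure lborel (R n \<inter> region)) \<longlonglongrightarrow> measure lborel (\<Inter>n. R n \<inter> region)"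
  proof (rule Lim_measure_decseq)
    have fm: "R n \<inter> region \<in> fmeasurable lborel" for n
      using fmeasurable_Int_fmeasurable[OF region_fmeasurable, of "R n"] Rb by (simp add: Int_commute)
    then show "range (\<lambda>n. R n \<inter> region) \<subseteq> sets lborel" using fmeasurableD by blast
    show "emeasure lborel (R n \<inter> region) \<noteq> \<infinity>" for n using fmeasurableD2[OF fm] by simp
    show "decseq (\<lambda>n. R n \<inter> region)" by (fastforce simp: decseq_def R_def)
  qed
  moreover have "(\<Inter>n. R n \<inter> region) = {}" by (auto simp: R_def)
  ultimately have "(\<lambda>n. measure lborel (R n \<inter> region)) \<longlonglongrightarrow> 0" by simp
  then have "(\<lambda>n. sqrt (measure lborel (R n \<inter> region) / cell_volume)) \<longlonglongrightarrow> sqrt (0 / cell_volume)"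
    using cell_volume_pos by (intro tendsto_real_sqrt tendsto_divide tendsto_const) auto
  then have "(\<lambda>n. sqrt (measure lborel (R n \<inter> region) / cell_volume)) \<longlonglongrightarrow> 0" by simp
  then have "(\<lambda>n. limit_measure (R n)) \<longlonglongrightarrow> 0"
    by (rule Lim_null_comparison[rotated]) (simp add: limit_measure_le_sqrt Rb)
  then have "(\<lambda>n. limit_measure (\<Union>i. A i) - limit_measure (R n)) \<longlonglongrightarrow> limit_measure (\<Union>i. A i) - 0"
    by (intro tendsto_diff tendsto_const)
  then show "(\<lambda>i. limit_measure (A i)) sums limit_measure (\<Union>i. A i)"
    by (simp add: sums_def flip: diff)
qed

lemma bounded_signed_measure_limit: "bounded_signed_measure limit_measure tv_bound"
proof
  fix A :: "'a set" assume A: "A \<in> sets borel"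
  show "\<bar>limit_measure A\<bar> \<le> tv_bound"
    unfolding tv_bound_def
  proof (intro order_trans[OF limit_measure_le_sqrt[OF A]] real_sqrt_le_mono divide_right_mono
      measure_mono_fmeasurable)
    show "A \<inter> region \<in> sets lborel" using A by (simp add: region_def)
  qed (use cell_volume_pos in auto)
qed (rule finite_signed_measure_limit)

lemma pseudo_probability_limit: "pseudo_probability_measure limit_measure"
proof -
  have "smooth n (indicator UNIV) = 1" for n
  proof -
    have "integral\<^sup>L (spread n x) (\<lambda>y. 1 :: real) = 1" for x
      using prob_space.prob_space[OF prob_space_spread, of n x] by simp
    then show ?thesis using casc_one[of n] by (simp add: smooth_def casc_eq_sum)
  qed
  then have "limit_measure UNIV = 1"
    using smooth_tendsto_limit_measure[of UNIV] by (simp add: LIMSEQ_const_iff)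
  then show ?thesis by (simp add: pseudo_probability_measure_def finite_signed_measure_limit)
qed

text \<open>Convergence on indicators extends to bounded Borel functions for the smoothed
  functionals; for continuous \<open>f\<close> the smoothing error vanishes, so the cascade has the
  same limit.\<close>

lemma weakly_converges_limit: "weakly_converges (cascade c G p) limit_measure"
  unfolding weakly_converges_def
proof (intro allI impI, elim conjE)
  interpret lim: bounded_signed_measure limit_measure tv_bound by (rule bounded_signed_measure_limit)
  fix f :: "'a \<Rightarrow> real" assume f: "continuous_on UNIV f" "bounded (range f)"
  then have fb: "bounded_borel f" by (rule bounded_borel_continuous)
  \<comment> \<open>The constant is doubled to match the one available for the signed integral
    against the limit.\<close>
  have smooth: "bounded_functional (2 * tv_bound) (smooth n)" for n
    using tv_bound_nonneg by (intro bounded_functional_mono[OF bounded_functional_smooth]) simp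
  have "(\<lambda>n. smooth n f) \<longlonglongrightarrow> signed_integral limit_measure f"
    using smooth lim.bounded_functional_signed_integral _ fb
    by (rule bounded_functional_tendsto)
      (simp add: lim.signed_integral_indicator smooth_tendsto_limit_measure)
  from tendsto_diff[OF this smooth_minus_casc_tendsto[OF f]]
  show "(\<lambda>n. signed_integral (cascade c G p n) f) \<longlonglongrightarrow> signed_integral limit_measure f"
    by (simp add: signed_integral_cascade[OF fb])
qed

end

section \<open>The integers and the Gaussian integers\<close>

lemma orthonormal_cascade_real:
  assumes "orthonormal_mask 2 \<int> p"
  shows "orthonormal_cascade (2::real) \<int> p"
proof
  show "1 \<le> norm x" if "x \<in> \<int>" "x \<noteq> 0" for x :: real
    using that by (rule Ints_nonzero_abs_ge1[of x, unfolded real_norm_def[symmetric]])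
qed (use assms in auto)

lemma orthonormal_cascade_complex:
  assumes "orthonormal_mask (1 + \<i>) gaussian_integers p"
  shows "orthonormal_cascade (1 + \<i>) gaussian_integers p"
proof
  show "norm (1 + \<i>) ^ DIM(complex) = 2" by (simp add: cmod_def)
  fix x y :: complex assume x: "x \<in> gaussian_integers"
  then show "(1 + \<i>) * x \<in> gaussian_integers" by (auto simp: gaussian_integers_def)
  show "x - y \<in> gaussian_integers" if "y \<in> gaussian_integers"
    using x that by (auto simp: gaussian_integers_def)
  \<comment> \<open>Some coordinate is a nonzero integer and already has absolute value at least
    1.\<close>
  show "1 \<le> norm x" if "x \<noteq> 0"
  proof (cases "Re x = 0")
    case True
    then have "Im x \<noteq> 0" using that by (simp add: complex_eq_iff)
    then have "1 \<le> \<bar>Im x\<bar>" using x by (intro Ints_nonzero_abs_ge1) (auto simp: gaussian_integers_def)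
    then show ?thesis using abs_Im_le_cmod[of x] by linarith
  next
    case False
    then have "1 \<le> \<bar>Re x\<bar>" using x by (intro Ints_nonzero_abs_ge1) (auto simp: gaussian_integers_def)
    then show ?thesis using abs_Re_le_cmod[of x] by linarith
  qed
qed (use assms in \<open>auto simp: gaussian_integers_def\<close>)

lemma (in orthonormal_cascade) cascade_conclusion:
  "(\<exists>B::real. \<forall>n\<ge>1. tv_norm (cascade c G p n) \<le> ennreal B) \<and>
   (\<forall>N::real. cardinality_bound c G p N \<longrightarrow> (\<forall>n\<ge>1. tv_norm (cascade c G p n) \<le> ennreal (sqrt N))) \<and>
   (\<exists>\<mu>. pseudo_probability_measure \<mu> \<and> weakly_converges (cascade c G p) \<mu>)"
  using tv_norm_cascade_bounded tv_norm_cascade_le_sqrt pseudo_probability_limit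
    weakly_converges_limit by blast

theorem corollary9:
  shows
    "(\<forall>p :: real \<Rightarrow> real. orthonormal_mask 2 \<int> p \<longrightarrow>
        (\<exists>B::real. \<forall>n\<ge>1. tv_norm (cascade 2 \<int> p n) \<le> ennreal B) \<and>
        (\<forall>N::real. cardinality_bound 2 \<int> p N \<longrightarrow>
           (\<forall>n\<ge>1. tv_norm (cascade 2 \<int> p n) \<le> ennreal (sqrt N))) \<and>
        (\<exists>\<mu>. pseudo_probability_measure \<mu> \<and> weakly_converges (cascade 2 \<int> p) \<mu>)) \<and>
     (\<forall>p :: complex \<Rightarrow> real. orthonormal_mask (1 + \<i>) gaussian_integers p \<longrightarrow>
        (\<exists>B::real. \<forall>n\<ge>1. tv_norm (cascade (1 + \<i>) gaussian_integers p n) \<le> ennreal B) \<and>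
        (\<forall>N::real. cardinality_bound (1 + \<i>) gaussian_integers p N \<longrightarrow>
           (\<forall>n\<ge>1. tv_norm (cascade (1 + \<i>) gaussian_integers p n) \<le> ennreal (sqrt N))) \<and>
        (\<exists>\<mu>. pseudo_probability_measure \<mu> \<and>
             weakly_converges (cascade (1 + \<i>) gaussian_integers p) \<mu>))"
  using orthonormal_cascade.cascade_conclusion[OF orthonormal_cascade_real]
    orthonormal_cascade.cascade_conclusion[OF orthonormal_cascade_complex] by blast

end
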